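(* Let $(X,Y_{\mathsf G})$ be real-valued random variables with a joint density, where $Y_{\mathsf G}$ is Gaussian, $0<\mathsf{var}(X)<\infty$ and $\rho(X,Y_{\mathsf G})\ne0$. For $\gamma\ge0$ let $Z_\gamma=\sqrt\gamma\,Y_{\mathsf G}+N_{\mathsf G}$ with $N_{\mathsf G}\sim\mathcal N(0,1)$ independent of $(X,Y_{\mathsf G})$. Then for every $\varepsilon\in[0,\rho_m^2(X,Y_{\mathsf G})]$, $$1-\frac{\varepsilon}{\rho^2(X,Y_{\mathsf G})}\le\mathsf{sENSR}(P_{XY_{\mathsf G}},\varepsilon)\le1-\frac{\varepsilon}{\rho_m^2(X,Y_{\mathsf G})}.$$
   Context: $\mathsf{mmse}(U|V)=\mathbb E[(U-\mathbb E[U|V])^2]$. $\rho$ denotes the Pearson correlation coefficient and $\rho_m(U,V)=\sup\rho(f(U),g(V))$ the maximal correlation, the supremum over measurable $f,g$ with $0<\mathsf{var}(f(U)),\mathsf{var}(g(V))<\infty$. For a pair $(X,Y)$ with joint density $P_{XY}$, $\mathsf{sENSR}(P_{XY},\varepsilon)=\inf_{\gamma}\mathsf{mmse}(Y|Z_\gamma)/\mathsf{var}(Y)$, where $Z_\gamma=\sqrt\gamma Y+N_{\mathsf G}$ and the infimum is over all $\gamma\ge0$ such that $\mathsf{mmse}(f(X)|Z_\gamma)\ge(1-\varepsilon)\mathsf{var}(f(X))$ for every measurable $f:\mathbb R\to\mathbb R$ with $\mathsf{var}(f(X))<\infty$. *)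

theory Defs
  imports "HOL-Probability.Probability"
begin

definition var_rv :: "'a measure \<Rightarrow> ('a \<Rightarrow> real) \<Rightarrow> real" where
  "var_rv M U = (\<integral>\<omega>. (U \<omega> - (\<integral>\<omega>'. U \<omega>' \<partial>M))\<^sup>2 \<partial>M)"

definition cov_rv :: "'a measure \<Rightarrow> ('a \<Rightarrow> real) \<Rightarrow> ('a \<Rightarrow> real) \<Rightarrow> real" where
  "cov_rv M U V = (\<integral>\<omega>. (U \<omega> - (\<integral>\<omega>'. U \<omega>' \<partial>M)) * (V \<omega> - (\<integral>\<omega>'. V \<omega>' \<partial>M)) \<partial>M)"

definition pearson :: "'a measure \<Rightarrow> ('a \<Rightarrow> real) \<Rightarrow> ('a \<Rightarrow> real) \<Rightarrow> real" where
  "pearson M U V = cov_rv M U V / (sqrt (var_rv M U) * sqrt (var_rv M V))"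

definition maxcorr :: "'a measure \<Rightarrow> ('a \<Rightarrow> real) \<Rightarrow> ('a \<Rightarrow> real) \<Rightarrow> real" where
  "maxcorr M U V = Sup {pearson M (\<lambda>\<omega>. f (U \<omega>)) (\<lambda>\<omega>. g (V \<omega>)) | f g.
     f \<in> borel_measurable borel \<and> g \<in> borel_measurable borel \<and>
     integrable M (\<lambda>\<omega>. (f (U \<omega>))\<^sup>2) \<and> 0 < var_rv M (\<lambda>\<omega>. f (U \<omega>)) \<and>
     integrable M (\<lambda>\<omega>. (g (V \<omega>))\<^sup>2) \<and> 0 < var_rv M (\<lambda>\<omega>. g (V \<omega>))}"

definition mmse :: "'a measure \<Rightarrow> ('a \<Rightarrow> real) \<Rightarrow> ('a \<Rightarrow> real) \<Rightarrow> real" where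
  "mmse M U V = (\<integral>\<omega>. (U \<omega> - real_cond_exp M (vimage_algebra (space M) V borel) U \<omega>)\<^sup>2 \<partial>M)"

text \<open>sENSR, with Z_gamma = sqrt gamma * Y + N, N the given standard Gaussian noise
  independent of (X,Y).\<close>
definition sENSR :: "'a measure \<Rightarrow> ('a \<Rightarrow> real) \<Rightarrow> ('a \<Rightarrow> real) \<Rightarrow> ('a \<Rightarrow> real) \<Rightarrow> real \<Rightarrow> real" where
  "sENSR M X Y N \<epsilon> = Inf {mmse M Y (\<lambda>\<omega>. sqrt \<gamma> * Y \<omega> + N \<omega>) / var_rv M Y | \<gamma>.
     \<gamma> \<ge> 0 \<and>
     (\<forall>f :: real \<Rightarrow> real. f \<in> borel_measurable borel \<longrightarrow> integrable M (\<lambda>\<omega>. (f (X \<omega>))\<^sup>2) \<longrightarrow>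
        mmse M (\<lambda>\<omega>. f (X \<omega>)) (\<lambda>\<omega>. sqrt \<gamma> * Y \<omega> + N \<omega>)
          \<ge> (1 - \<epsilon>) * var_rv M (\<lambda>\<omega>. f (X \<omega>)))}"

end

theory Submission
  imports Defs
begin

text \<open>
  With $s^2 = \gamma\sigma^2/(1+\gamma\sigma^2)$, the standardised $Z_\gamma$ is $s V + \sqrt{1-s^2}\, N$
  for the standardised $V$ of $Y$, so conditioning a function of $Z_\gamma$ on $Y$ is the Mehler operator
  $T_s$ on $L^2$ of the Gaussian. Its norm on mean-zero functions is $s$. Since $X - Y - Z_\gamma$ is a
  Markov chain, this gives $\mathrm{mmse}(f(X)|Z_\gamma) \ge (1 - \rho_m^2 s^2)\,\mathrm{var} f(X)$, and in the same
  way $\mathrm{mmse}(Y|Z_\gamma) \ge (1 - s^2)\,\mathrm{var}\, Y$. Linear estimation gives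
  $\mathrm{mmse}(X|Z_\gamma) \le (1 - \rho^2 s^2)\,\mathrm{var}\, X$ and equality in the bound for $Y$. Hence
  $\rho_m^2 s^2 \le \varepsilon$ is sufficient for $\gamma$ to be admissible, $\rho^2 s^2 \le \varepsilon$ is
  necessary, and the objective is $1 - s^2$.

  The norm of $T_s$ is found without Hermite polynomials. For $g$ of mean zero the form
  $B(t) = \langle g, T_t g\rangle$ satisfies $|B(t)| \le C t \|g\|^2$ for $t \le s$ by the
  Hilbert-Schmidt norm of the kernel minus one, and $B(t)^2 \le \|g\|^2 \|T_t g\|^2 = \|g\|^2 B(t^2)$.
  Feeding the first bound into the second replaces $C$ by $\sqrt C$; iterating, $C$ tends to one.
\<close>

section \<open>The Cauchy-Schwarz inequality for integrals\<close>

lemma Cauchy_Schwarz_integral: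
  fixes f g :: "'a \<Rightarrow> real"
  assumes [measurable]: "f \<in> borel_measurable M" "g \<in> borel_measurable M"
    and f: "integrable M (\<lambda>x. (f x)\<^sup>2)" and g: "integrable M (\<lambda>x. (g x)\<^sup>2)"
  shows "integrable M (\<lambda>x. f x * g x)"
    and "(\<integral>x. f x * g x \<partial>M)\<^sup>2 \<le> (\<integral>x. (f x)\<^sup>2 \<partial>M) * (\<integral>x. (g x)\<^sup>2 \<partial>M)"
proof -
  show fg: "integrable M (\<lambda>x. f x * g x)"
  proof (rule Bochner_Integration.integrable_bound[OF Bochner_Integration.integrable_add[OF f g]])
    show "AE x in M. norm (f x * g x) \<le> norm ((f x)\<^sup>2 + (g x)\<^sup>2)"
    proof (rule AE_I2)
      fix x
      have "0 \<le> (\<bar>f x\<bar> - \<bar>g x\<bar>)\<^sup>2 + (f x)\<^sup>2 + (g x)\<^sup>2" by simp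
      then have "2 * \<bar>f x * g x\<bar> \<le> 2 * ((f x)\<^sup>2 + (g x)\<^sup>2)"
        by (simp add: power2_diff abs_mult)
      then show "norm (f x * g x) \<le> norm ((f x)\<^sup>2 + (g x)\<^sup>2)" by simp
    qed
  qed simp
  define A B C where "A = (\<integral>x. (f x)\<^sup>2 \<partial>M)" "B = (\<integral>x. f x * g x \<partial>M)" "C = (\<integral>x. (g x)\<^sup>2 \<partial>M)"
  \<comment> \<open>A discriminant argument: the integral of a square is a quadratic form in
    \<open>u\<close> and \<open>v\<close> that is nowhere negative.\<close>
  have *: "0 \<le> u\<^sup>2 * A + 2 * u * v * B + v\<^sup>2 * C" for u v :: real
  proof -
    have "0 \<le> (\<integral>x. (u * f x + v * g x)\<^sup>2 \<partial>M)" by simp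
    also have "\<dots> = (\<integral>x. u\<^sup>2 * (f x)\<^sup>2 + 2 * u * v * (f x * g x) + v\<^sup>2 * (g x)\<^sup>2 \<partial>M)"
      by (intro Bochner_Integration.integral_cong refl) (simp add: power2_eq_square algebra_simps)
    also have "\<dots> = u\<^sup>2 * A + 2 * u * v * B + v\<^sup>2 * C"
      unfolding A_B_C_def using f g fg by simp
    finally show ?thesis .
  qed
  have "A \<ge> 0" by (simp add: A_B_C_def)
  have "B\<^sup>2 \<le> A * C"
  proof (cases "A = 0")
    case True
    have "0 \<le> 2 * u * B + C" for u using *[of u 1] True by simp
    \<comment> \<open>If \<open>B\<close> were nonzero, this \<open>u\<close> would give the value
      \<open>-1\<close>.\<close>
    from this[of "- (C + 1) / (2 * B)"] have "B = 0"
      by (cases "B = 0") (simp_all add: field_simps)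
    then show ?thesis using True by simp
  next
    case False
    have "0 \<le> A * (A * C - B\<^sup>2)"
      using *[of B "-A"] by (simp add: power2_eq_square algebra_simps)
    with False \<open>A \<ge> 0\<close> show ?thesis by (simp add: zero_le_mult_iff)
  qed
  then show "(\<integral>x. f x * g x \<partial>M)\<^sup>2 \<le> (\<integral>x. (f x)\<^sup>2 \<partial>M) * (\<integral>x. (g x)\<^sup>2 \<partial>M)"
    unfolding A_B_C_def .
qed

subsection \<open>The Mehler kernel\<close>

definition gauss :: "real measure" where
  "gauss = density lborel (\<lambda>x. ennreal (std_normal_density x))"

lemma sets_gauss [measurable_cong, simp]: "sets gauss = sets borel"
  and space_gauss [simp]: "space gauss = UNIV"
  by (simp_all add: gauss_def)

lemma prob_space_gauss: "prob_space gauss"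
  unfolding gauss_def by (rule prob_space_normal_density) simp

interpretation gauss: prob_space gauss by (rule prob_space_gauss)
interpretation gauss2: pair_prob_space gauss gauss ..

lemma integrable_gauss_iff:
  fixes f :: "real \<Rightarrow> real"
  assumes "f \<in> borel_measurable borel"
  shows "integrable gauss f \<longleftrightarrow> integrable lborel (\<lambda>x. std_normal_density x * f x)"
  unfolding gauss_def using assms by (subst integrable_density) auto

lemma integral_gauss_eq:
  fixes f :: "real \<Rightarrow> real"
  assumes "f \<in> borel_measurable borel"
  shows "integral\<^sup>L gauss f = (\<integral>x. std_normal_density x * f x \<partial>lborel)"
  unfolding gauss_def using assms by (subst integral_density) auto

lemma distr_gauss_affine:
  assumes "0 < c"
  shows "distr gauss borel (\<lambda>w. m + c * w) = density lborel (\<lambda>x. ennreal (normal_density m c x))"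
proof -
  have "distr gauss lborel (\<lambda>x. x) = gauss"
    by (rule distr_id2) (simp add: gauss_def)
  then have "distributed gauss lborel (\<lambda>x. x) (normal_density 0 1)"
    by (simp add: distributed_def gauss_def)
  from gauss.normal_density_affine[OF this, of c m] assms
  have "distributed gauss lborel (\<lambda>x. m + x * c) (normal_density m c)" by (simp add: mult.commute)
  then have "distr gauss lborel (\<lambda>x. m + x * c) = density lborel (\<lambda>x. ennreal (normal_density m c x))"
    by (simp add: distributed_def)
  moreover have "distr gauss lborel (\<lambda>x. m + x * c) = distr gauss borel (\<lambda>w. m + c * w)"
    by (rule distr_cong) (auto simp: mult.commute)
  ultimately show ?thesis by simp
qed

text \<open>The density, with respect to the standard Gaussian, of the law of $s x + \sqrt{1 - s^2}\, w$
  for Gaussian $w$.\<close>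

definition mehler :: "real \<Rightarrow> real \<Rightarrow> real \<Rightarrow> real" where
  "mehler s x y = exp ((2 * s * x * y - s\<^sup>2 * x\<^sup>2 - s\<^sup>2 * y\<^sup>2) / (2 * (1 - s\<^sup>2))) / sqrt (1 - s\<^sup>2)"

lemma measurable_mehler [measurable (raw)]:
  assumes [measurable]: "f \<in> borel_measurable M" "g \<in> borel_measurable M"
  shows "(\<lambda>x. mehler s (f x) (g x)) \<in> borel_measurable M"
  unfolding mehler_def by measurable

lemma mehler_commute: "mehler s x y = mehler s y x"
  unfolding mehler_def by (simp add: algebra_simps)

lemma square_less_one: "0 \<le> s \<Longrightarrow> s < 1 \<Longrightarrow> s\<^sup>2 < (1 :: real)"
  by (simp add: power_less_one_iff)

lemma mehler_pos: "0 \<le> s \<Longrightarrow> s < 1 \<Longrightarrow> 0 < mehler s x y"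
  unfolding mehler_def using square_less_one[of s] by simp

text \<open>Complete the square in \<open>y\<close>. Integrals of the kernel against
  \<open>gauss\<close> thereby become integrals of a normal density.\<close>

lemma std_normal_mult_mehler:
  assumes "0 \<le> s" "s < 1"
  shows "std_normal_density y * mehler s x y = normal_density (s * x) (sqrt (1 - s\<^sup>2)) y"
proof -
  note s = square_less_one[OF assms]
  have "- y\<^sup>2 / 2 + (2 * s * x * y - s\<^sup>2 * x\<^sup>2 - s\<^sup>2 * y\<^sup>2) / (2 * (1 - s\<^sup>2)) =
      - (y - s * x)\<^sup>2 / (2 * (1 - s\<^sup>2))"
    using s by (simp add: divide_simps) (simp add: power2_eq_square algebra_simps)
  then show ?thesis
    using s unfolding mehler_def normal_density_def
    by (simp add: exp_add[symmetric] real_sqrt_mult)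
qed

text \<open>The density form of Chapman-Kolmogorov. The exponent is quadratic in \<open>y\<close>
  with precision \<open>(1 + s\<^sup>2) / (1 - s\<^sup>2)\<close>; completing the square leaves the
  kernel at \<open>s\<^sup>2\<close> as the part free of \<open>y\<close>.\<close>

lemma std_normal_mult_mehler_mult_mehler:
  assumes "0 \<le> s" "s < 1"
  shows "std_normal_density y * (mehler s x y * mehler s y z) =
    mehler (s\<^sup>2) x z * normal_density (s * (x + z) / (1 + s\<^sup>2)) (sqrt ((1 - s\<^sup>2) / (1 + s\<^sup>2))) y"
proof -
  define q where "q = s\<^sup>2"
  have q: "q < 1" "0 \<le> q" using square_less_one[OF assms] by (simp_all add: q_def)
  have q2: "1 - q\<^sup>2 = (1 - q) * (1 + q)" by (simp add: power2_eq_square algebra_simps)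
  have e: "- y\<^sup>2 / 2 + (2 * s * x * y - s\<^sup>2 * x\<^sup>2 - s\<^sup>2 * y\<^sup>2) / (2 * (1 - q)) +
        (2 * s * y * z - s\<^sup>2 * y\<^sup>2 - s\<^sup>2 * z\<^sup>2) / (2 * (1 - q)) =
      (2 * q * x * z - q\<^sup>2 * x\<^sup>2 - q\<^sup>2 * z\<^sup>2) / (2 * ((1 - q) * (1 + q)))
      - (y - s * (x + z) / (1 + q))\<^sup>2 / (2 * ((1 - q) / (1 + q)))"
  proof -
    have "(y - s * (x + z) / (1 + q)) = (y * (1 + q) - s * (x + z)) / (1 + q)"
      using q by (simp add: field_simps)
    then have "(y - s * (x + z) / (1 + q))\<^sup>2 / (2 * ((1 - q) / (1 + q)))
      = (y * (1 + q) - s * (x + z))\<^sup>2 / (2 * ((1 - q) * (1 + q)))"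
      using q by (simp add: power_divide divide_simps power2_eq_square)
    moreover have "(y * (1 + q) - s * (x + z))\<^sup>2 = y\<^sup>2 * (1 + q)\<^sup>2 - 2 * y * (1 + q) * s * (x + z) + q * (x + z)\<^sup>2"
      by (simp add: q_def power2_eq_square algebra_simps)
    moreover have "- y\<^sup>2 / 2 + (2 * s * x * y - q * x\<^sup>2 - q * y\<^sup>2) / (2 * (1 - q)) +
        (2 * s * y * z - q * y\<^sup>2 - q * z\<^sup>2) / (2 * (1 - q)) =
      (2 * q * x * z - q\<^sup>2 * x\<^sup>2 - q\<^sup>2 * z\<^sup>2) / (2 * ((1 - q) * (1 + q)))
      - (y\<^sup>2 * (1 + q)\<^sup>2 - 2 * y * (1 + q) * s * (x + z) + q * (x + z)\<^sup>2) / (2 * ((1 - q) * (1 + q)))"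
      using q by (simp add: divide_simps) (simp add: power2_eq_square algebra_simps)
    ultimately show ?thesis by (simp add: q_def)
  qed
  have p: "std_normal_density y * (mehler s x y * mehler s y z) =
     exp (- y\<^sup>2 / 2 + (2 * s * x * y - s\<^sup>2 * x\<^sup>2 - s\<^sup>2 * y\<^sup>2) / (2 * (1 - q)) +
        (2 * s * y * z - s\<^sup>2 * y\<^sup>2 - s\<^sup>2 * z\<^sup>2) / (2 * (1 - q))) / (sqrt (2 * pi) * (1 - q))"
    unfolding mehler_def normal_density_def exp_add using q by (simp add: q_def)
  \<comment> \<open>The prefactors agree: \<open>1 / (1 - q)\<close> from two kernels, against that
    of one kernel at \<open>q\<close> times the normalisation of the normal density.\<close>
  have r: "sqrt ((1 - q) * (1 + q)) * sqrt (2 * pi * ((1 - q) / (1 + q))) = sqrt (2 * pi) * (1 - q)"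
  proof -
    have "sqrt ((1 - q) * (1 + q)) * sqrt (2 * pi * ((1 - q) / (1 + q))) =
       sqrt (((1 - q) * (1 + q)) * (2 * pi * ((1 - q) / (1 + q))))"
      by (rule real_sqrt_mult[symmetric])
    also have "\<dots> = sqrt (2 * pi * (1 - q)\<^sup>2)"
      by (rule arg_cong[where f=sqrt]) (use q in \<open>simp add: divide_simps power2_eq_square\<close>)
    also have "\<dots> = sqrt (2 * pi) * (1 - q)" using q by (simp add: real_sqrt_mult)
    finally show ?thesis .
  qed
  \<comment> \<open>An abstract pattern that the unfolded product matches as it stands, before
    simplification can disturb its shape.\<close>
  have exp_merge: "exp A / a * (1 / b * exp (- n / d)) = exp (A - n / d) / (a * b)" for A a b n d :: real
    by (simp add: exp_diff exp_minus divide_inverse)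
  have "0 < (1 - q) / (1 + q)" using q by simp
  then have sq: "(sqrt ((1 - q) / (1 + q)))\<^sup>2 = (1 - q) / (1 + q)" by simp
  have "mehler (s\<^sup>2) x z * normal_density (s * (x + z) / (1 + q)) (sqrt ((1 - q) / (1 + q))) y =
     exp ((2 * q * x * z - q\<^sup>2 * x\<^sup>2 - q\<^sup>2 * z\<^sup>2) / (2 * ((1 - q) * (1 + q)))
      - (y - s * (x + z) / (1 + q))\<^sup>2 / (2 * ((1 - q) / (1 + q)))) /
     (sqrt ((1 - q) * (1 + q)) * sqrt (2 * pi * ((1 - q) / (1 + q))))"
    unfolding mehler_def normal_density_def sq q_def[symmetric] q2 by (rule exp_merge)
  then show ?thesis unfolding p r e by (simp add: q_def)
qed

text \<open>On the diagonal the exponent is a multiple of \<open>x\<^sup>2\<close>, so only a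
  centred normal density and its total mass remain. This prepares the trace.\<close>

lemma std_normal_mult_mehler_diag:
  assumes "0 \<le> t" "t < 1"
  shows "std_normal_density x * mehler t x x = 1 / (1 - t) * normal_density 0 (sqrt ((1 + t) / (1 - t))) x"
proof -
  have t2: "1 - t\<^sup>2 = (1 - t) * (1 + t)" by (simp add: power2_eq_square algebra_simps)
  have e: "- x\<^sup>2 / 2 + (2 * t * x * x - t\<^sup>2 * x\<^sup>2 - t\<^sup>2 * x\<^sup>2) / (2 * ((1 - t) * (1 + t))) =
     - x\<^sup>2 / (2 * ((1 + t) / (1 - t)))"
    using assms by (simp add: divide_simps) (simp add: power2_eq_square algebra_simps)
  have sq: "(sqrt ((1 + t) / (1 - t)))\<^sup>2 = (1 + t) / (1 - t)" using assms by simp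
  have r: "sqrt (2 * pi) * sqrt ((1 - t) * (1 + t)) = (1 - t) * sqrt (2 * pi * ((1 + t) / (1 - t)))"
  proof -
    have "sqrt (2 * pi) * sqrt ((1 - t) * (1 + t)) = sqrt ((1 - t)\<^sup>2 * (2 * pi * ((1 + t) / (1 - t))))"
      unfolding real_sqrt_mult[symmetric]
      by (rule arg_cong[where f=sqrt]) (use assms in \<open>simp add: divide_simps power2_eq_square\<close>)
    also have "\<dots> = (1 - t) * sqrt (2 * pi * ((1 + t) / (1 - t)))"
      unfolding real_sqrt_mult[of "(1 - t)\<^sup>2"] using assms by simp
    finally show ?thesis .
  qed
  have "std_normal_density x * mehler t x x =
    exp (- x\<^sup>2 / 2 + (2 * t * x * x - t\<^sup>2 * x\<^sup>2 - t\<^sup>2 * x\<^sup>2) / (2 * ((1 - t) * (1 + t)))) /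
     (sqrt (2 * pi) * sqrt ((1 - t) * (1 + t)))"
    unfolding mehler_def normal_density_def exp_add t2 by simp
  also have "\<dots> = 1 / (1 - t) * normal_density 0 (sqrt ((1 + t) / (1 - t))) x"
    unfolding e r normal_density_def sq by simp
  finally show ?thesis .
qed

lemma mehler_integral:
  assumes s: "0 \<le> s" "s < 1"
  shows "integrable gauss (mehler s x)" "integral\<^sup>L gauss (mehler s x) = 1"
proof -
  have "0 < sqrt (1 - s\<^sup>2)" using square_less_one[OF s] by simp
  then show "integrable gauss (mehler s x)" "integral\<^sup>L gauss (mehler s x) = 1"
    by (simp_all add: integrable_gauss_iff integral_gauss_eq std_normal_mult_mehler[OF s])
qed

text \<open>Two steps of correlation \<open>s\<close> compose to one of correlation
  \<open>s\<^sup>2\<close>: in the product formula the normal factor in \<open>y\<close> has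
  integral one.\<close>

lemma mehler_semigroup:
  assumes s: "0 \<le> s" "s < 1"
  shows "integrable gauss (\<lambda>y. mehler s x y * mehler s y z)"
    "(\<integral>y. mehler s x y * mehler s y z \<partial>gauss) = mehler (s\<^sup>2) x z"
proof -
  have "0 < (1 - s\<^sup>2) / (1 + s\<^sup>2)"
    using square_less_one[OF s] by (simp add: add_pos_nonneg)
  then have "0 < sqrt ((1 - s\<^sup>2) / (1 + s\<^sup>2))" by simp
  then show "integrable gauss (\<lambda>y. mehler s x y * mehler s y z)"
    "(\<integral>y. mehler s x y * mehler s y z \<partial>gauss) = mehler (s\<^sup>2) x z"
    by (simp_all add: integrable_gauss_iff integral_gauss_eq std_normal_mult_mehler_mult_mehler[OF s]
       del: real_sqrt_gt_0_iff)
qed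

text \<open>The trace of the Mehler operator, whose eigenvalues are the powers of
  \<open>t\<close>.\<close>

lemma mehler_diag_integral:
  assumes t: "0 \<le> t" "t < 1"
  shows "integrable gauss (\<lambda>x. mehler t x x)" "(\<integral>x. mehler t x x \<partial>gauss) = 1 / (1 - t)"
proof -
  have "0 < sqrt ((1 + t) / (1 - t))" using t by simp
  then show "integrable gauss (\<lambda>x. mehler t x x)" "(\<integral>x. mehler t x x \<partial>gauss) = 1 / (1 - t)"
    by (simp_all add: integrable_gauss_iff integral_gauss_eq std_normal_mult_mehler_diag[OF t]
       del: real_sqrt_gt_0_iff)
qed

lemma distr_gauss_mehler:
  assumes s: "0 \<le> s" "s < 1"
  shows "distr gauss borel (\<lambda>w. s * x + sqrt (1 - s\<^sup>2) * w) = density gauss (\<lambda>y. ennreal (mehler s x y))"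
proof -
  have "0 < sqrt (1 - s\<^sup>2)" using square_less_one[OF s] by simp
  then have "distr gauss borel (\<lambda>w. s * x + sqrt (1 - s\<^sup>2) * w) =
      density lborel (\<lambda>y. ennreal (std_normal_density y) * ennreal (mehler s x y))"
    by (simp add: distr_gauss_affine std_normal_mult_mehler[OF s, symmetric] ennreal_mult
        less_imp_le[OF mehler_pos[OF s]])
  then show ?thesis unfolding gauss_def by (simp add: density_density_eq)
qed

subsection \<open>Contraction of the Mehler operator\<close>

lemma integrable_gauss_pair_mult:
  fixes a b :: "real \<Rightarrow> real"
  assumes a: "integrable gauss a" and b: "integrable gauss b"
  shows "integrable (gauss \<Otimes>\<^sub>M gauss) (\<lambda>p. a (fst p) * b (snd p))"
    and "(\<integral>p. a (fst p) * b (snd p) \<partial>(gauss \<Otimes>\<^sub>M gauss)) = integral\<^sup>L gauss a * integral\<^sup>L gauss b"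
proof -
  have [measurable]: "a \<in> borel_measurable borel" "b \<in> borel_measurable borel"
    using a b by (auto dest: borel_measurable_integrable)
  show i: "integrable (gauss \<Otimes>\<^sub>M gauss) (\<lambda>p. a (fst p) * b (snd p))"
    by (rule gauss2.Fubini_integrable) (use a b in \<open>auto simp: abs_mult\<close>)
  show "(\<integral>p. a (fst p) * b (snd p) \<partial>(gauss \<Otimes>\<^sub>M gauss)) = integral\<^sup>L gauss a * integral\<^sup>L gauss b"
    using gauss2.integral_fst'[OF i] by simp
qed

text \<open>The semigroup identity with \<open>z = x\<close> turns the inner integral of the squared
  kernel into the diagonal of the kernel at \<open>s\<^sup>2\<close>, so the double integral is the
  trace \<open>1 / (1 - s\<^sup>2)\<close>. Subtracting one from the kernel removes the constant
  functions and lowers this by one.\<close>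

lemma mehler_hilbert_schmidt:
  assumes s: "0 \<le> s" "s < 1"
  shows "integrable (gauss \<Otimes>\<^sub>M gauss) (\<lambda>p. (mehler s (fst p) (snd p))\<^sup>2)"
    and "integrable (gauss \<Otimes>\<^sub>M gauss) (\<lambda>p. (mehler s (fst p) (snd p) - 1)\<^sup>2)"
    and "(\<integral>p. (mehler s (fst p) (snd p) - 1)\<^sup>2 \<partial>(gauss \<Otimes>\<^sub>M gauss)) = s\<^sup>2 / (1 - s\<^sup>2)"
proof -
  let ?K = "\<lambda>p. mehler s (fst p) (snd p)"
  note s2 = square_less_one[OF s]
  have sq: "integrable gauss (\<lambda>y. (mehler s x y)\<^sup>2)" "(\<integral>y. (mehler s x y)\<^sup>2 \<partial>gauss) = mehler (s\<^sup>2) x x" for x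
    using mehler_semigroup[OF s, of x x] by (simp_all add: mehler_commute[of s _ x] power2_eq_square)
  show i2: "integrable (gauss \<Otimes>\<^sub>M gauss) (\<lambda>p. (?K p)\<^sup>2)"
    by (rule gauss2.Fubini_integrable) (simp_all add: sq mehler_diag_integral s2)
  have e2: "(\<integral>p. (?K p)\<^sup>2 \<partial>(gauss \<Otimes>\<^sub>M gauss)) = 1 / (1 - s\<^sup>2)"
    using gauss2.integral_fst'[OF i2] by (simp add: sq mehler_diag_integral s2)
  have i1: "integrable (gauss \<Otimes>\<^sub>M gauss) ?K"
    by (rule gauss2.Fubini_integrable) (simp_all add: mehler_integral[OF s] less_imp_le[OF mehler_pos[OF s]])
  have e1: "(\<integral>p. ?K p \<partial>(gauss \<Otimes>\<^sub>M gauss)) = 1"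
    using gauss2.integral_fst'[OF i1] by (simp add: mehler_integral[OF s] gauss.prob_space[unfolded space_gauss])
  have eq: "(?K p - 1)\<^sup>2 = (?K p)\<^sup>2 - 2 * ?K p + 1" for p by (simp add: power2_diff)
  show "integrable (gauss \<Otimes>\<^sub>M gauss) (\<lambda>p. (?K p - 1)\<^sup>2)"
    unfolding eq using i1 i2 by simp
  show "(\<integral>p. (?K p - 1)\<^sup>2 \<partial>(gauss \<Otimes>\<^sub>M gauss)) = s\<^sup>2 / (1 - s\<^sup>2)"
    unfolding eq using i1 i2 e1 e2 s2 gauss2.prob_space by (simp add: field_simps)
qed

text \<open>For \<open>0 < s < 1\<close> this is the Ornstein-Uhlenbeck semigroup at time
  \<open>- ln s\<close>.\<close>

definition mehler_op :: "real \<Rightarrow> (real \<Rightarrow> real) \<Rightarrow> real \<Rightarrow> real" where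
  "mehler_op s g x = (\<integral>y. g y * mehler s x y \<partial>gauss)"

text \<open>The pairing of \<open>g\<close> with \<open>mehler_op s g\<close>, written as one
  integral over the product space so that the Hilbert-Schmidt norm of the kernel can be
  used.\<close>

definition mehler_form :: "real \<Rightarrow> (real \<Rightarrow> real) \<Rightarrow> real" where
  "mehler_form s g = (\<integral>p. (g (fst p) * g (snd p)) * mehler s (fst p) (snd p) \<partial>(gauss \<Otimes>\<^sub>M gauss))"

lemma measurable_mehler_op [measurable]:
  assumes [measurable]: "g \<in> borel_measurable borel"
  shows "mehler_op s g \<in> borel_measurable borel"
  unfolding mehler_op_def by measurable

context
  fixes g :: "real \<Rightarrow> real"
  assumes g [measurable]: "g \<in> borel_measurable borel"
    and g2: "integrable gauss (\<lambda>x. (g x)\<^sup>2)"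
begin

lemma integrable_mehler_op:
  assumes s: "0 \<le> s" "s < 1"
  shows "integrable gauss (\<lambda>y. g y * mehler s x y)"
proof (rule Cauchy_Schwarz_integral(1)[OF _ _ g2])
  show "integrable gauss (\<lambda>y. (mehler s x y)\<^sup>2)"
    using mehler_semigroup(1)[OF s, of x x] by (simp add: mehler_commute[of s _ x] power2_eq_square)
qed simp_all

lemma gauss_pair_square:
  shows "integrable (gauss \<Otimes>\<^sub>M gauss) (\<lambda>p. (g (fst p) * g (snd p))\<^sup>2)"
    and "(\<integral>p. (g (fst p) * g (snd p))\<^sup>2 \<partial>(gauss \<Otimes>\<^sub>M gauss)) = (\<integral>x. (g x)\<^sup>2 \<partial>gauss)\<^sup>2"
  using integrable_gauss_pair_mult[OF g2 g2]
  by (simp_all add: power_mult_distrib power2_eq_square[of "\<integral>x. (g x)\<^sup>2 \<partial>gauss"])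

lemma integrable_mehler_form:
  assumes s: "0 \<le> s" "s < 1"
  shows "integrable (gauss \<Otimes>\<^sub>M gauss) (\<lambda>p. (g (fst p) * g (snd p)) * mehler s (fst p) (snd p))"
  by (rule Cauchy_Schwarz_integral(1)[OF _ _ gauss_pair_square(1) mehler_hilbert_schmidt(1)[OF s]]) simp_all

text \<open>The operator is symmetric and its square is the operator at \<open>s\<^sup>2\<close>, so
  the squared norm of the image is the form at \<open>s\<^sup>2\<close>. Concretely, the squared
  image is a double integral, and Fubini integrates the shared variable \<open>x\<close>
  first.\<close>

lemma mehler_op_square:
  assumes s: "0 \<le> s" "s < 1"
  shows "integrable gauss (\<lambda>x. (mehler_op s g x)\<^sup>2)"
    and "(\<integral>x. (mehler_op s g x)\<^sup>2 \<partial>gauss) = mehler_form (s\<^sup>2) g"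
proof -
  interpret P: pair_sigma_finite "gauss \<Otimes>\<^sub>M gauss" gauss ..
  define F where "F p x = (g (fst p) * g (snd p)) * (mehler s (fst p) x * mehler s x (snd p))"
    for p x
  note s2 = square_less_one[OF s]
  have [measurable]: "case_prod F \<in> borel_measurable ((gauss \<Otimes>\<^sub>M gauss) \<Otimes>\<^sub>M gauss)"
    unfolding F_def by measurable
  have K: "\<bar>mehler s x y\<bar> = mehler s x y" for x y
    using mehler_pos[OF s, of x y] by simp
  have "0 \<le> mehler (s\<^sup>2) x y" for x y
    using mehler_pos[OF _ s2, of x y] by simp
  \<comment> \<open>The kernel is nonnegative, so absolute values affect only the factors of
    \<open>g\<close>, and the semigroup identity still evaluates the inner integral exactly.\<close>
  then have nF: "(\<integral>x. norm (F p x) \<partial>gauss) = norm ((g (fst p) * g (snd p)) * mehler (s\<^sup>2) (fst p) (snd p))" for p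
    using mehler_semigroup[OF s, of "fst p" "snd p"] by (simp add: F_def abs_mult K)
  have iF: "integrable ((gauss \<Otimes>\<^sub>M gauss) \<Otimes>\<^sub>M gauss) (case_prod F)"
  proof (rule P.Fubini_integrable)
    show "integrable (gauss \<Otimes>\<^sub>M gauss) (\<lambda>p. \<integral>x. norm (case_prod F (p, x)) \<partial>gauss)"
      unfolding prod.case nF by (rule integrable_norm[OF integrable_mehler_form]) (simp_all add: s2)
    show "AE p in gauss \<Otimes>\<^sub>M gauss. integrable gauss (\<lambda>x. case_prod F (p, x))"
      unfolding F_def prod.case by (intro AE_I2 integrable_mult_right mehler_semigroup[OF s])
  qed simp
  \<comment> \<open>For fixed \<open>x\<close> the integrand splits into two factors of one variable
    each.\<close>
  have sq: "(\<integral>p. F p x \<partial>(gauss \<Otimes>\<^sub>M gauss)) = (mehler_op s g x)\<^sup>2" for x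
    using integrable_gauss_pair_mult(2)[OF integrable_mehler_op[OF s, of x] integrable_mehler_op[OF s, of x]]
    unfolding mehler_op_def F_def by (simp add: power2_eq_square mehler_commute[of s _ x] mult_ac)
  show "integrable gauss (\<lambda>x. (mehler_op s g x)\<^sup>2)"
    using P.integrable_snd[OF iF] by (simp add: sq)
  show "(\<integral>x. (mehler_op s g x)\<^sup>2 \<partial>gauss) = mehler_form (s\<^sup>2) g"
    using P.Fubini_integral[OF iF] unfolding sq
    by (simp add: F_def mehler_form_def mehler_semigroup(2)[OF s])
qed

text \<open>Cauchy-Schwarz for \<open>g\<close> and its image. With the squared norm of
  \<open>g\<close> read as the form at \<open>s = 1\<close>, this is midpoint log-convexity in
  \<open>ln s\<close>, hence the name.\<close>

lemma mehler_form_log_convex: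
  assumes s: "0 \<le> s" "s < 1"
  shows "(mehler_form s g)\<^sup>2 \<le> (\<integral>x. (g x)\<^sup>2 \<partial>gauss) * mehler_form (s\<^sup>2) g"
proof -
  have "mehler_form s g = (\<integral>x. g x * mehler_op s g x \<partial>gauss)"
    using gauss2.integral_fst'[OF integrable_mehler_form[OF s]]
    unfolding mehler_form_def mehler_op_def by (simp add: mult.assoc)
  then show ?thesis
    using Cauchy_Schwarz_integral(2)[OF _ _ g2 mehler_op_square(1)[OF s]]
    by (simp add: mehler_op_square(2)[OF s])
qed

text \<open>A mean-zero \<open>g\<close> does not see a constant added to the kernel, so the kernel
  minus one may replace it. Its Hilbert-Schmidt norm is of order \<open>s\<close>, the linear decay
  from which the iteration starts.\<close>

lemma mehler_form_crude_bound:
  assumes s: "0 \<le> s" "s < 1" and mean: "integral\<^sup>L gauss g = 0"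
  shows "(mehler_form s g)\<^sup>2 \<le> (\<integral>x. (g x)\<^sup>2 \<partial>gauss)\<^sup>2 * (s\<^sup>2 / (1 - s\<^sup>2))"
proof -
  have "integrable gauss (\<lambda>x. g x * 1)"
    by (rule Cauchy_Schwarz_integral(1)[OF _ _ g2]) simp_all
  then have g1: "integrable gauss g" by simp
  note gg = integrable_gauss_pair_mult[OF g1 g1]
  have "mehler_form s g =
      (\<integral>p. (g (fst p) * g (snd p)) * (mehler s (fst p) (snd p) - 1) \<partial>(gauss \<Otimes>\<^sub>M gauss))"
    using integrable_mehler_form[OF s] gg mean by (simp add: mehler_form_def algebra_simps)
  then show ?thesis
    using Cauchy_Schwarz_integral(2)[OF _ _ gauss_pair_square(1) mehler_hilbert_schmidt(2)[OF s]]
    by (simp add: gauss_pair_square(2) mehler_hilbert_schmidt(3)[OF s])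
qed

lemma mehler_form_bound:
  assumes s: "0 \<le> s" "s < 1" and mean: "integral\<^sup>L gauss g = 0"
  shows "mehler_form s g \<le> s * (\<integral>x. (g x)\<^sup>2 \<partial>gauss)"
proof -
  define A where "A = (\<integral>x. (g x)\<^sup>2 \<partial>gauss)"
  \<comment> \<open>Chosen so that \<open>t\<^sup>2 / (1 - t\<^sup>2) \<le> t\<^sup>2 * C\<close>
    for all \<open>t \<le> s\<close> at once.\<close>
  define C where "C = 1 / (1 - s\<^sup>2)"
  note s2 = square_less_one[OF s]
  have A: "0 \<le> A" by (simp add: A_def)
  have C: "0 < C" using s2 by (simp add: C_def)
  \<comment> \<open>Quantified over all \<open>t \<le> s\<close>, since the step at \<open>t\<close>
    calls the hypothesis at \<open>t\<^sup>2\<close>. Each step takes one square root of the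
    constant, that is, halves its exponent.\<close>
  have bound: "\<forall>t. 0 \<le> t \<and> t \<le> s \<longrightarrow> (mehler_form t g)\<^sup>2 \<le> C powr ((1 / 2) ^ k) * (t * A)\<^sup>2" for k
  proof (induction k)
    case 0
    show ?case
    proof (intro allI impI)
      fix t assume t: "0 \<le> t \<and> t \<le> s"
      then have "t\<^sup>2 \<le> s\<^sup>2" by (intro power_mono) auto
      then have "t\<^sup>2 / (1 - t\<^sup>2) \<le> t\<^sup>2 * C"
        using s2 unfolding C_def by (simp add: frac_le)
      then have "A\<^sup>2 * (t\<^sup>2 / (1 - t\<^sup>2)) \<le> A\<^sup>2 * (t\<^sup>2 * C)" by (rule mult_left_mono) simp
      with mehler_form_crude_bound[of t, OF _ _ mean] t s C
      show "(mehler_form t g)\<^sup>2 \<le> C powr ((1 / 2) ^ 0) * (t * A)\<^sup>2"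
        by (simp add: A_def power_mult_distrib mult_ac)
    qed
  next
    case (Suc k)
    show ?case
    proof (intro allI impI)
      fix t assume t: "0 \<le> t \<and> t \<le> s"
      define c where "c = C powr ((1 / 2) ^ Suc k)"
      have c2: "C powr ((1 / 2) ^ k) = c\<^sup>2"
        using C by (simp add: c_def powr_power)
      have c0: "0 \<le> c" by (simp add: c_def)
      have "t\<^sup>2 \<le> t" using t s by (simp add: power2_eq_square mult_left_le)
      then have "0 \<le> t\<^sup>2 \<and> t\<^sup>2 \<le> s" using t by auto
      with Suc have "(mehler_form (t\<^sup>2) g)\<^sup>2 \<le> c\<^sup>2 * (t\<^sup>2 * A)\<^sup>2"
        unfolding c2 by blast
      then have "(mehler_form (t\<^sup>2) g)\<^sup>2 \<le> (c * (t\<^sup>2 * A))\<^sup>2"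
        by (simp only: power_mult_distrib)
      then have "mehler_form (t\<^sup>2) g \<le> c * (t\<^sup>2 * A)"
        by (rule power2_le_imp_le) (use c0 A in simp)
      then have "A * mehler_form (t\<^sup>2) g \<le> A * (c * (t\<^sup>2 * A))"
        using A by (rule mult_left_mono)
      with mehler_form_log_convex[of t] t s
      show "(mehler_form t g)\<^sup>2 \<le> c * (t * A)\<^sup>2"
        by (simp add: A_def power2_eq_square mult_ac)
    qed
  qed
  \<comment> \<open>The exponent tends to zero with growing \<open>k\<close>, hence the constant to
    one.\<close>
  have "(\<lambda>k. C powr ((1 / 2) ^ k) * (s * A)\<^sup>2) \<longlonglongrightarrow> C powr 0 * (s * A)\<^sup>2"
    using C by (intro tendsto_intros LIMSEQ_realpow_zero) auto
  then have "(mehler_form s g)\<^sup>2 \<le> C powr 0 * (s * A)\<^sup>2"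
    by (rule LIMSEQ_le_const) (use bound s in auto)
  then have "(mehler_form s g)\<^sup>2 \<le> (s * A)\<^sup>2" using C by simp
  then show ?thesis unfolding A_def[symmetric]
    by (rule power2_le_imp_le) (use s A in simp)
qed

text \<open>The form bound at \<open>s\<^sup>2\<close>, read through the norm identity. The factor
  is sharp: the operator multiplies the identity function by \<open>s\<close>.\<close>

lemma mehler_op_contraction:
  assumes "0 \<le> s" "s < 1" and "integral\<^sup>L gauss g = 0"
  shows "(\<integral>x. (mehler_op s g x)\<^sup>2 \<partial>gauss) \<le> s\<^sup>2 * (\<integral>x. (g x)\<^sup>2 \<partial>gauss)"
  using mehler_form_bound[of "s\<^sup>2"] square_less_one[OF assms(1,2)] assms
  by (simp add: mehler_op_square(2))

end

subsection \<open>Correlation and mean square error\<close>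

text \<open>The Doob-Dynkin lemma: \<open>H\<close> is determined by its sublevel sets at rational
  levels, and each of them is a preimage under \<open>Z\<close>.\<close>

lemma vimage_algebra_factor:
  fixes H :: "'a \<Rightarrow> real"
  assumes Z: "Z \<in> \<Omega> \<rightarrow> space N" and H: "H \<in> borel_measurable (vimage_algebra \<Omega> Z N)"
  obtains h where "h \<in> borel_measurable N" "\<And>\<omega>. \<omega> \<in> \<Omega> \<Longrightarrow> H \<omega> = h (Z \<omega>)"
proof -
  have "\<exists>A\<in>sets N. {\<omega>\<in>\<Omega>. H \<omega> < of_rat q} = Z -` A \<inter> \<Omega>" for q
  proof -
    have "{\<omega>\<in>space (vimage_algebra \<Omega> Z N). H \<omega> < of_rat q} \<in> sets (vimage_algebra \<Omega> Z N)"
      using H by measurable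
    then show ?thesis using Z by (auto simp: sets_vimage_algebra2)
  qed
  then obtain A where A [measurable]: "\<And>q. A q \<in> sets N"
    and eq: "\<And>q. {\<omega>\<in>\<Omega>. H \<omega> < of_rat q} = Z -` A q \<inter> \<Omega>"
    by metis
  \<comment> \<open>A real is the infimum of the rationals above it; the extended reals give a value off the range of \<open>Z\<close>.\<close>
  define h where "h z = real_of_ereal (INF q. if z \<in> A q then ereal (of_rat q) else \<infinity>)" for z
  show thesis
  proof
    show "h \<in> borel_measurable N" unfolding h_def by measurable
    fix \<omega> assume \<omega>: "\<omega> \<in> \<Omega>"
    have mem: "Z \<omega> \<in> A q \<longleftrightarrow> H \<omega> < of_rat q" for q using eq[of q] \<omega> by auto
    have "(INF q. if Z \<omega> \<in> A q then ereal (of_rat q) else \<infinity>) = ereal (H \<omega>)"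
    proof (rule INF_eqI)
      show "ereal (H \<omega>) \<le> (if Z \<omega> \<in> A q then ereal (of_rat q) else \<infinity>)" for q
        by (simp add: mem)
    next
      fix y assume y: "\<And>q. q \<in> UNIV \<Longrightarrow> y \<le> (if Z \<omega> \<in> A q then ereal (of_rat q) else \<infinity>)"
      show "y \<le> ereal (H \<omega>)"
      proof (rule ccontr)
        assume "\<not> y \<le> ereal (H \<omega>)"
        then obtain r where r: "ereal (H \<omega>) < ereal r" "ereal r < y"
          using ereal_dense2[of "ereal (H \<omega>)" y] by (auto simp: not_le)
        then obtain q where "H \<omega> < of_rat q" "of_rat q < r"
          using of_rat_dense[of "H \<omega>" r] by auto
        moreover from this y[of q] have "y \<le> ereal (of_rat q)" by (simp add: mem)
        ultimately show False using r by (meson ereal_less_le less_ereal.simps(1) not_le order.strict_trans)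
      qed
    qed
    then show "H \<omega> = h (Z \<omega>)" by (simp add: h_def)
  qed
qed

context prob_space
begin

lemma integrable_of_square:
  fixes U :: "'a \<Rightarrow> real"
  assumes "U \<in> borel_measurable M" "integrable M (\<lambda>\<omega>. (U \<omega>)\<^sup>2)"
  shows "integrable M U"
  using Cauchy_Schwarz_integral(1)[of U M "\<lambda>_. 1"] assms by simp

lemma integrable_diff_square:
  fixes U V :: "'a \<Rightarrow> real"
  assumes "U \<in> borel_measurable M" "integrable M (\<lambda>\<omega>. (U \<omega>)\<^sup>2)"
    and "V \<in> borel_measurable M" "integrable M (\<lambda>\<omega>. (V \<omega>)\<^sup>2)"
  shows "integrable M (\<lambda>\<omega>. (U \<omega> - V \<omega>)\<^sup>2)"
  unfolding power2_diff using assms Cauchy_Schwarz_integral(1)[of U M V]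
  by (simp add: mult.assoc)

lemma cov_rv_square_le:
  assumes [measurable]: "U \<in> borel_measurable M" "V \<in> borel_measurable M"
    and "integrable M (\<lambda>\<omega>. (U \<omega>)\<^sup>2)" "integrable M (\<lambda>\<omega>. (V \<omega>)\<^sup>2)"
  shows "(cov_rv M U V)\<^sup>2 \<le> var_rv M U * var_rv M V"
  unfolding cov_rv_def var_rv_def
  by (rule Cauchy_Schwarz_integral(2)) (use assms in \<open>auto intro!: integrable_diff_square\<close>)

lemma pearson_square:
  assumes "0 \<le> var_rv M U" "0 \<le> var_rv M V"
  shows "(pearson M U V)\<^sup>2 = (cov_rv M U V)\<^sup>2 / (var_rv M U * var_rv M V)"
  using assms by (simp add: pearson_def power_divide power_mult_distrib)

lemma var_rv_nonneg: "0 \<le> var_rv M U"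
  by (simp add: var_rv_def)

text \<open>With denominators cleared the bound also covers functions of variance zero, where
  Cauchy-Schwarz makes the covariance vanish.\<close>

lemma cov_rv_le_maxcorr:
  assumes [measurable]: "X \<in> borel_measurable M" "Y \<in> borel_measurable M"
      "f \<in> borel_measurable borel" "g \<in> borel_measurable borel"
    and f: "integrable M (\<lambda>\<omega>. (f (X \<omega>))\<^sup>2)" and g: "integrable M (\<lambda>\<omega>. (g (Y \<omega>))\<^sup>2)"
  shows "(cov_rv M (\<lambda>\<omega>. f (X \<omega>)) (\<lambda>\<omega>. g (Y \<omega>)))\<^sup>2 \<le>
    (maxcorr M X Y)\<^sup>2 * (var_rv M (\<lambda>\<omega>. f (X \<omega>)) * var_rv M (\<lambda>\<omega>. g (Y \<omega>)))"
proof (cases "var_rv M (\<lambda>\<omega>. f (X \<omega>)) = 0 \<or> var_rv M (\<lambda>\<omega>. g (Y \<omega>)) = 0")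
  case True
  then show ?thesis
    using cov_rv_square_le[of "\<lambda>\<omega>. f (X \<omega>)" "\<lambda>\<omega>. g (Y \<omega>)"] f g by auto
next
  case False
  then have pos: "0 < var_rv M (\<lambda>\<omega>. f (X \<omega>))" "0 < var_rv M (\<lambda>\<omega>. g (Y \<omega>))"
    using var_rv_nonneg[of "\<lambda>\<omega>. f (X \<omega>)"] var_rv_nonneg[of "\<lambda>\<omega>. g (Y \<omega>)"] by linarith+
  define S where "S = {pearson M (\<lambda>\<omega>. f (X \<omega>)) (\<lambda>\<omega>. g (Y \<omega>)) | f g.
     f \<in> borel_measurable borel \<and> g \<in> borel_measurable borel \<and>
     integrable M (\<lambda>\<omega>. (f (X \<omega>))\<^sup>2) \<and> 0 < var_rv M (\<lambda>\<omega>. f (X \<omega>)) \<and>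
     integrable M (\<lambda>\<omega>. (g (Y \<omega>))\<^sup>2) \<and> 0 < var_rv M (\<lambda>\<omega>. g (Y \<omega>))}"
  \<comment> \<open>A real \<open>Sup\<close> dominates the elements of a set only if that set is
    bounded above; here correlations are at most one.\<close>
  have bdd: "bdd_above S"
  proof (rule bdd_aboveI)
    fix r assume "r \<in> S"
    then obtain f g where r: "r = pearson M (\<lambda>\<omega>. f (X \<omega>)) (\<lambda>\<omega>. g (Y \<omega>))"
      and [measurable]: "f \<in> borel_measurable borel" "g \<in> borel_measurable borel"
      and fg: "integrable M (\<lambda>\<omega>. (f (X \<omega>))\<^sup>2)" "0 < var_rv M (\<lambda>\<omega>. f (X \<omega>))"
        "integrable M (\<lambda>\<omega>. (g (Y \<omega>))\<^sup>2)" "0 < var_rv M (\<lambda>\<omega>. g (Y \<omega>))"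
      unfolding S_def by blast
    have "r\<^sup>2 \<le> 1"
      using cov_rv_square_le[of "\<lambda>\<omega>. f (X \<omega>)" "\<lambda>\<omega>. g (Y \<omega>)"] fg
      by (simp add: r pearson_square var_rv_nonneg divide_le_eq)
    then show "r \<le> 1" using power2_le_imp_le[of r 1] by simp
  qed
  have 1: "pearson M (\<lambda>\<omega>. f (X \<omega>)) (\<lambda>\<omega>. g (Y \<omega>)) \<in> S"
    unfolding S_def
    by (rule CollectI, rule exI[of _ f], rule exI[of _ g]) (use f g pos in simp)
  \<comment> \<open>\<open>maxcorr\<close> takes no absolute values; passing from \<open>f\<close>
    to its negative shows that it bounds the negated correlation too.\<close>
  have neg: "var_rv M (\<lambda>\<omega>. - f (X \<omega>)) = var_rv M (\<lambda>\<omega>. f (X \<omega>))"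
    "cov_rv M (\<lambda>\<omega>. - f (X \<omega>)) (\<lambda>\<omega>. g (Y \<omega>)) = - cov_rv M (\<lambda>\<omega>. f (X \<omega>)) (\<lambda>\<omega>. g (Y \<omega>))"
    unfolding var_rv_def cov_rv_def Bochner_Integration.integral_minus[symmetric]
    by (auto intro!: Bochner_Integration.integral_cong simp: power2_eq_square algebra_simps)
  have "pearson M (\<lambda>\<omega>. - f (X \<omega>)) (\<lambda>\<omega>. g (Y \<omega>)) \<in> S"
    unfolding S_def
    by (rule CollectI, rule exI[of _ "\<lambda>x. - f x"], rule exI[of _ g]) (use f g pos in \<open>simp add: neg\<close>)
  then have "- pearson M (\<lambda>\<omega>. f (X \<omega>)) (\<lambda>\<omega>. g (Y \<omega>)) \<in> S"
    by (simp add: pearson_def neg)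
  with 1 have "\<bar>pearson M (\<lambda>\<omega>. f (X \<omega>)) (\<lambda>\<omega>. g (Y \<omega>))\<bar> \<le> maxcorr M X Y"
    unfolding maxcorr_def S_def[symmetric] using cSup_upper[OF _ bdd] by (simp add: abs_le_iff)
  then have "(pearson M (\<lambda>\<omega>. f (X \<omega>)) (\<lambda>\<omega>. g (Y \<omega>)))\<^sup>2 \<le> (maxcorr M X Y)\<^sup>2"
    using power_mono[of "\<bar>pearson M (\<lambda>\<omega>. f (X \<omega>)) (\<lambda>\<omega>. g (Y \<omega>))\<bar>" "maxcorr M X Y" 2] by simp
  then show ?thesis
    using pos by (simp add: pearson_square var_rv_nonneg divide_le_eq)
qed

text \<open>Conditional expectation as the orthogonal projection onto the square-integrable
  functions of \<open>Z\<close>. Conditional Jensen for the square keeps it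
  square-integrable.\<close>

lemma cond_exp_vimage_square:
  fixes U Z :: "'a \<Rightarrow> real"
  assumes [measurable]: "U \<in> borel_measurable M" "Z \<in> borel_measurable M"
    and U2: "integrable M (\<lambda>\<omega>. (U \<omega>)\<^sup>2)"
  defines "F \<equiv> vimage_algebra (space M) Z borel"
  shows "integrable M (\<lambda>\<omega>. (real_cond_exp M F U \<omega>)\<^sup>2)"
    and "real_cond_exp M F U \<in> borel_measurable M"
    and "\<And>l. l \<in> borel_measurable F \<Longrightarrow> integrable M (\<lambda>\<omega>. (l \<omega>)\<^sup>2) \<Longrightarrow>
      (\<integral>\<omega>. l \<omega> * real_cond_exp M F U \<omega> \<partial>M) = (\<integral>\<omega>. l \<omega> * U \<omega> \<partial>M)"
    and "expectation (real_cond_exp M F U) = expectation U"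
proof -
  have "subalgebra M F"
    using sets_image_in_sets[of M "space M" Z borel] by (simp add: subalgebra_def F_def)
  then interpret finite_measure_subalgebra M F by unfold_locales
  note U1 = integrable_of_square[OF _ U2]
  show "integrable M (\<lambda>\<omega>. (real_cond_exp M F U \<omega>)\<^sup>2)"
    by (rule integrable_convex_cond_exp[where I=UNIV]) (use U1 U2 in \<open>auto simp: convex_power2\<close>)
  show "real_cond_exp M F U \<in> borel_measurable M" by simp
  have *: "l \<in> borel_measurable M" if "l \<in> borel_measurable F" for l :: "'a \<Rightarrow> real"
    using that by (rule measurable_from_subalg[OF subalg])
  show "(\<integral>\<omega>. l \<omega> * real_cond_exp M F U \<omega> \<partial>M) = (\<integral>\<omega>. l \<omega> * U \<omega> \<partial>M)"
    if "l \<in> borel_measurable F" "integrable M (\<lambda>\<omega>. (l \<omega>)\<^sup>2)" for l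
    using Cauchy_Schwarz_integral(1)[OF *[OF that(1)] _ that(2) U2] that(1)
    by (intro real_cond_exp_intg(2)) auto
  show "expectation (real_cond_exp M F U) = expectation U"
    using U1 by (intro real_cond_exp_int) auto
qed

text \<open>The residual of the projection is orthogonal to square-integrable functions of
  \<open>Z\<close>, so the cross term drops out. An affine \<open>l\<close> will give upper bounds
  on the error, a constant \<open>l\<close> the decomposition of the variance.\<close>

lemma mmse_pythagoras:
  fixes U Z :: "'a \<Rightarrow> real" and l :: "real \<Rightarrow> real"
  assumes [measurable]: "U \<in> borel_measurable M" "Z \<in> borel_measurable M"
    and U2: "integrable M (\<lambda>\<omega>. (U \<omega>)\<^sup>2)"
    and l [measurable]: "l \<in> borel_measurable borel" and l2: "integrable M (\<lambda>\<omega>. (l (Z \<omega>))\<^sup>2)"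
  shows "expectation (\<lambda>\<omega>. (U \<omega> - l (Z \<omega>))\<^sup>2) = mmse M U Z +
    expectation (\<lambda>\<omega>. (real_cond_exp M (vimage_algebra (space M) Z borel) U \<omega> - l (Z \<omega>))\<^sup>2)"
proof -
  define F where "F = vimage_algebra (space M) Z borel"
  define H where "H = real_cond_exp M F U"
  note c = cond_exp_vimage_square[of U Z, OF _ _ U2, folded F_def, folded H_def]
  have [measurable]: "H \<in> borel_measurable M" by (rule c) auto
  have lF: "(\<lambda>\<omega>. l (Z \<omega>)) \<in> borel_measurable F"
    unfolding F_def by (rule measurable_compose[OF measurable_vimage_algebra1]) auto
  have HF: "H \<in> borel_measurable F" by (simp add: H_def)
  have H2: "integrable M (\<lambda>\<omega>. (H \<omega>)\<^sup>2)" by (rule c) auto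
  have Hl2: "integrable M (\<lambda>\<omega>. (H \<omega> - l (Z \<omega>))\<^sup>2)"
    by (intro integrable_diff_square H2 l2) auto
  have UH2: "integrable M (\<lambda>\<omega>. (U \<omega> - H \<omega>)\<^sup>2)"
    by (intro integrable_diff_square H2 U2) auto
  have i: "integrable M (\<lambda>\<omega>. (H \<omega> - l (Z \<omega>)) * U \<omega>)" "integrable M (\<lambda>\<omega>. (H \<omega> - l (Z \<omega>)) * H \<omega>)"
    using Cauchy_Schwarz_integral(1)[OF _ _ Hl2 U2] Cauchy_Schwarz_integral(1)[OF _ _ Hl2 H2] by auto
  have "expectation (\<lambda>\<omega>. (H \<omega> - l (Z \<omega>)) * H \<omega>) = expectation (\<lambda>\<omega>. (H \<omega> - l (Z \<omega>)) * U \<omega>)"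
    by (rule c(3)[OF _ _ _ Hl2]) (use lF HF in auto)
  then have orth: "expectation (\<lambda>\<omega>. (H \<omega> - l (Z \<omega>)) * U \<omega> - (H \<omega> - l (Z \<omega>)) * H \<omega>) = 0"
    using i by simp
  have "expectation (\<lambda>\<omega>. (U \<omega> - l (Z \<omega>))\<^sup>2) = expectation (\<lambda>\<omega>. (U \<omega> - H \<omega>)\<^sup>2 +
      2 * ((H \<omega> - l (Z \<omega>)) * U \<omega> - (H \<omega> - l (Z \<omega>)) * H \<omega>) + (H \<omega> - l (Z \<omega>))\<^sup>2)"
    by (intro Bochner_Integration.integral_cong refl) (simp add: power2_eq_square algebra_simps)
  also have "\<dots> = expectation (\<lambda>\<omega>. (U \<omega> - H \<omega>)\<^sup>2) + expectation (\<lambda>\<omega>. (H \<omega> - l (Z \<omega>))\<^sup>2)"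
    using i UH2 Hl2 orth by simp
  finally show ?thesis by (simp add: mmse_def H_def F_def)
qed

lemma mmse_le_estimator:
  fixes U Z :: "'a \<Rightarrow> real" and l :: "real \<Rightarrow> real"
  assumes "U \<in> borel_measurable M" "Z \<in> borel_measurable M" "integrable M (\<lambda>\<omega>. (U \<omega>)\<^sup>2)"
    and "l \<in> borel_measurable borel" "integrable M (\<lambda>\<omega>. (l (Z \<omega>))\<^sup>2)"
  shows "mmse M U Z \<le> expectation (\<lambda>\<omega>. (U \<omega> - l (Z \<omega>))\<^sup>2)"
  using mmse_pythagoras[OF assms] by simp

end

subsection \<open>The Gaussian channel\<close>

text \<open>A function of \<open>A\<close> generates a sub-sigma-algebra of that of
  \<open>A\<close>. This passes independence from a pair to whatever is computed from it.\<close>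

lemma (in prob_space) indep_set_vimage_compose:
  assumes ind: "indep_set (sets (vimage_algebra (space M) A L)) S"
    and A: "A \<in> measurable M L" and \<phi>: "\<phi> \<in> measurable L L'"
  shows "indep_set (sets (vimage_algebra (space M) (\<lambda>\<omega>. \<phi> (A \<omega>)) L')) S"
proof -
  have "(\<lambda>\<omega>. \<phi> (A \<omega>)) \<in> measurable (vimage_algebra (space M) A L) L'"
    using measurable_space[OF A] by (intro measurable_compose[OF measurable_vimage_algebra1 \<phi>]) auto
  then have "sets (vimage_algebra (space M) (\<lambda>\<omega>. \<phi> (A \<omega>)) L') \<subseteq> sets (vimage_algebra (space M) A L)"
    by (intro sets_image_in_sets) simp_all
  with ind show ?thesis
    unfolding indep_set_def by (elim indep_sets_mono_sets) (auto split: bool.split)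
qed

text \<open>Joint law and product law agree on rectangles, which determine them. The form with
  \<open>indep_set\<close> suits a pair and a real noise, which have different types;
  \<open>indep_var\<close> takes variables of one type.\<close>

lemma (in prob_space) indep_set_vimage_distr:
  assumes ind: "indep_set (sets (vimage_algebra (space M) A L)) (sets (vimage_algebra (space M) B L'))"
    and A [measurable]: "A \<in> measurable M L" and B [measurable]: "B \<in> measurable M L'"
  shows "distr M L A \<Otimes>\<^sub>M distr M L' B = distr M (L \<Otimes>\<^sub>M L') (\<lambda>\<omega>. (A \<omega>, B \<omega>))"
proof -
  interpret A: prob_space "distr M L A" by (rule prob_space_distr) fact
  interpret B: prob_space "distr M L' B" by (rule prob_space_distr) fact
  show ?thesis
  proof (rule pair_measure_eqI)
    fix C D assume "C \<in> sets (distr M L A)" "D \<in> sets (distr M L' B)"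
    then have C [measurable]: "C \<in> sets L" and D [measurable]: "D \<in> sets L'" by auto
    have "emeasure (distr M (L \<Otimes>\<^sub>M L') (\<lambda>\<omega>. (A \<omega>, B \<omega>))) (C \<times> D) =
        emeasure M ((A -` C \<inter> space M) \<inter> (B -` D \<inter> space M))"
      by (subst emeasure_distr) (auto intro!: arg_cong[where f="emeasure M"])
    also have "\<dots> = emeasure M (A -` C \<inter> space M) * emeasure M (B -` D \<inter> space M)"
      using indep_setD[OF ind in_vimage_algebra[OF C] in_vimage_algebra[OF D]]
      by (simp add: emeasure_eq_measure ennreal_mult)
    finally show "emeasure (distr M L A) C * emeasure (distr M L' B) D =
        emeasure (distr M (L \<Otimes>\<^sub>M L') (\<lambda>\<omega>. (A \<omega>, B \<omega>))) (C \<times> D)"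
      by (simp add: emeasure_distr)
  qed (auto intro: A.sigma_finite_measure_axioms B.sigma_finite_measure_axioms)
qed

lemma (in prob_space) indep_var_vimage:
  assumes "indep_set (sets (vimage_algebra (space M) A L)) (sets (vimage_algebra (space M) B L'))"
    and "A \<in> measurable M L" and "B \<in> measurable M L'"
  shows "indep_var L A L' B"
  using assms unfolding indep_var_eq sets_vimage_algebra by simp

text \<open>The variances \<open>s\<^sup>2\<close> and \<open>1 - s\<^sup>2\<close> of independent
  centred normals add to one.\<close>

lemma (in prob_space) distributed_std_normal_rotate:
  assumes s: "0 \<le> s" "s < 1"
    and ind: "indep_var borel V borel W"
    and V: "distributed M lborel V std_normal_density" and W: "distributed M lborel W std_normal_density"
  shows "distributed M lborel (\<lambda>\<omega>. s * V \<omega> + sqrt (1 - s\<^sup>2) * W \<omega>) std_normal_density"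
proof (cases "s = 0")
  \<comment> \<open>Here the first summand is constant and has no density; the sum is just
    \<open>W\<close>.\<close>
  case True
  then show ?thesis using W by simp
next
  case False
  define c where "c = sqrt (1 - s\<^sup>2)"
  have c: "0 < c" "s\<^sup>2 + c\<^sup>2 = 1" using square_less_one[OF s] by (simp_all add: c_def)
  have "indep_var borel ((\<lambda>v. s * v) \<circ> V) borel ((\<lambda>w. c * w) \<circ> W)"
    by (rule indep_var_compose[OF ind]) simp_all
  then have "indep_var borel (\<lambda>\<omega>. s * V \<omega>) borel (\<lambda>\<omega>. c * W \<omega>)" by (simp add: comp_def)
  moreover have "distributed M lborel (\<lambda>\<omega>. s * V \<omega>) (normal_density 0 s)"
    using normal_density_affine[OF V, of s 0] s False by simp
  moreover have "distributed M lborel (\<lambda>\<omega>. c * W \<omega>) (normal_density 0 c)"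
    using normal_density_affine[OF W, of c 0] c by simp
  ultimately have "distributed M lborel (\<lambda>\<omega>. s * V \<omega> + c * W \<omega>) (normal_density (0 + 0) (sqrt (s\<^sup>2 + c\<^sup>2)))"
    using s False c by (intro add_indep_normal) auto
  then show ?thesis using c by (simp add: c_def)
qed

lemma distr_std_normal:
  assumes "distributed M lborel V std_normal_density"
  shows "distr M borel V = gauss"
proof -
  have "distr M borel V = distr M lborel V" by (rule distr_cong) simp_all
  also have "\<dots> = gauss" using assms by (simp add: distributed_def gauss_def)
  finally show ?thesis .
qed

text \<open>Averaging out the noise applies the Mehler operator, because the kernel is the density
  of the affine image.\<close>

lemma integral_gauss_affine_mehler:
  assumes s: "0 \<le> s" "s < 1" and [measurable]: "g \<in> borel_measurable borel"
  shows "(\<integral>w. g (s * v + sqrt (1 - s\<^sup>2) * w) \<partial>gauss) = mehler_op s g v"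
proof -
  have "(\<integral>w. g (s * v + sqrt (1 - s\<^sup>2) * w) \<partial>gauss) =
      integral\<^sup>L (distr gauss borel (\<lambda>w. s * v + sqrt (1 - s\<^sup>2) * w)) g"
    by (subst integral_distr) auto
  also have "\<dots> = (\<integral>y. mehler s v y * g y \<partial>gauss)"
    unfolding distr_gauss_mehler[OF s]
    by (subst integral_density) (auto simp: less_imp_le[OF mehler_pos[OF s]])
  finally show ?thesis by (simp add: mehler_op_def mult.commute)
qed

text \<open>The variance explained by \<open>Z\<close> is the squared norm \<open>q\<close> of a
  mean-zero function of the normalised output. Integrating out \<open>W\<close> replaces that
  function by its Mehler image in \<open>V\<close>; then \<open>corr\<close> and the contraction
  bound \<open>q\<^sup>2\<close> by \<open>c * s\<^sup>2 * var_rv M U * q\<close>. The constant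
  \<open>c\<close> bounds the squared correlation of \<open>U\<close> with functions of
  \<open>V\<close>.\<close>

lemma (in prob_space) mmse_gaussian_channel_ge:
  fixes U V W Z :: "'a \<Rightarrow> real"
  assumes s: "0 \<le> s" "s < 1"
    and U [measurable]: "U \<in> borel_measurable M" and U2: "integrable M (\<lambda>\<omega>. (U \<omega>)\<^sup>2)"
    and ind: "indep_set (sets (vimage_algebra (space M) (\<lambda>\<omega>. (U \<omega>, V \<omega>)) (borel \<Otimes>\<^sub>M borel)))
      (sets (vimage_algebra (space M) W borel))"
    and V: "distributed M lborel V std_normal_density" and W: "distributed M lborel W std_normal_density"
    and Z: "\<And>\<omega>. Z \<omega> = m + k * (s * V \<omega> + sqrt (1 - s\<^sup>2) * W \<omega>)"
    and c: "0 \<le> c" and corr: "\<And>w. w \<in> borel_measurable borel \<Longrightarrow> integrable M (\<lambda>\<omega>. (w (V \<omega>))\<^sup>2) \<Longrightarrow>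
      (expectation (\<lambda>\<omega>. (U \<omega> - expectation U) * w (V \<omega>)))\<^sup>2 \<le>
        c * var_rv M U * expectation (\<lambda>\<omega>. (w (V \<omega>))\<^sup>2)"
  shows "(1 - c * s\<^sup>2) * var_rv M U \<le> mmse M U Z"
proof -
  have Vm [measurable]: "V \<in> borel_measurable M" and Wm [measurable]: "W \<in> borel_measurable M"
    using V W by (auto simp: distributed_def)
  define S where "S \<omega> = s * V \<omega> + sqrt (1 - s\<^sup>2) * W \<omega>" for \<omega>
  have [measurable]: "S \<in> borel_measurable M" unfolding S_def by measurable
  have Zm [measurable]: "Z \<in> borel_measurable M" unfolding Z[abs_def] by measurable
  have "indep_var borel V borel W"
    by (rule indep_var_vimage) (use indep_set_vimage_compose[OF ind, of snd borel] in simp_all)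
  note dS = distr_std_normal[OF distributed_std_normal_rotate[OF s this V W], folded S_def]
  note dV = distr_std_normal[OF V] and dW = distr_std_normal[OF W]
  define J where "J = distr M (borel \<Otimes>\<^sub>M borel) (\<lambda>\<omega>. (U \<omega>, V \<omega>))"
  have sets_J [measurable_cong]: "sets J = sets (borel \<Otimes>\<^sub>M borel)" by (simp add: J_def)
  \<comment> \<open>The Markov chain from \<open>U\<close> through \<open>V\<close> to
    \<open>Z\<close> enters here: the noise is independent of the pair jointly.\<close>
  have joint: "J \<Otimes>\<^sub>M gauss = distr M ((borel \<Otimes>\<^sub>M borel) \<Otimes>\<^sub>M borel) (\<lambda>\<omega>. ((U \<omega>, V \<omega>), W \<omega>))"
    using indep_set_vimage_distr[OF ind] by (simp add: J_def dW)
  interpret J: prob_space J unfolding J_def by (rule prob_space_distr) simp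
  interpret JG: pair_prob_space J gauss ..

  define F where "F = vimage_algebra (space M) Z borel"
  define H where "H = real_cond_exp M F U"
  define a where "a = expectation U"
  note H = cond_exp_vimage_square[OF U Zm U2, folded F_def, folded H_def a_def]
  have "H \<in> borel_measurable F" by (simp add: H_def)
  then obtain h where h [measurable]: "h \<in> borel_measurable borel"
    and Hh: "\<And>\<omega>. \<omega> \<in> space M \<Longrightarrow> H \<omega> = h (Z \<omega>)"
    unfolding F_def by (rule vimage_algebra_factor[rotated]) auto
  \<comment> \<open>The conditional mean, centred and rewritten as a function of the standard normal
    \<open>S\<close>, so that the contraction applies.\<close>
  define g where "g y = h (m + k * y) - a" for y
  have g [measurable]: "g \<in> borel_measurable borel" unfolding g_def by measurable
  have gS: "H \<omega> - a = g (S \<omega>)" if "\<omega> \<in> space M" for \<omega>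
    using Hh[OF that] by (simp add: g_def S_def Z)
  have gS2: "integrable M (\<lambda>\<omega>. (g (S \<omega>))\<^sup>2)"
  proof -
    have "integrable M (\<lambda>\<omega>. (H \<omega> - a)\<^sup>2)"
      by (rule integrable_diff_square) (use H in auto)
    then show ?thesis by (simp add: gS cong: Bochner_Integration.integrable_cong)
  qed
  have to_gauss: "expectation (\<lambda>\<omega>. f (S \<omega>)) = integral\<^sup>L gauss f"
     "expectation (\<lambda>\<omega>. f (V \<omega>)) = integral\<^sup>L gauss f"
     "integrable M (\<lambda>\<omega>. f (S \<omega>)) \<longleftrightarrow> integrable gauss f"
     "integrable M (\<lambda>\<omega>. f (V \<omega>)) \<longleftrightarrow> integrable gauss f"
    if [measurable]: "f \<in> borel_measurable borel" for f :: "real \<Rightarrow> real"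
    using integral_distr[of S M borel f] integral_distr[of V M borel f]
      integrable_distr_eq[of S M borel f] integrable_distr_eq[of V M borel f]
    by (simp_all add: dS dV)
  have g2: "integrable gauss (\<lambda>y. (g y)\<^sup>2)"
    using gS2 to_gauss(3)[of "\<lambda>y. (g y)\<^sup>2"] by simp
  have mean: "integral\<^sup>L gauss g = 0"
  proof -
    have "expectation (\<lambda>\<omega>. g (S \<omega>)) = expectation (\<lambda>\<omega>. H \<omega> - a)"
      by (intro Bochner_Integration.integral_cong refl) (simp add: gS)
    also have "\<dots> = 0"
      using integrable_of_square[OF H(2,1)] H(4) prob_space by simp
    finally show ?thesis using to_gauss(1)[OF g] by simp
  qed
  define q where "q = integral\<^sup>L gauss (\<lambda>y. (g y)\<^sup>2)"
  have q: "0 \<le> q" by (simp add: q_def)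
  have qM: "expectation (\<lambda>\<omega>. (g (S \<omega>))\<^sup>2) = q"
    unfolding q_def by (rule to_gauss) simp

  have "expectation (\<lambda>\<omega>. (H \<omega> - a)\<^sup>2) = q"
    unfolding qM[symmetric] by (intro Bochner_Integration.integral_cong refl) (simp add: gS)
  \<comment> \<open>Pythagoras with the constant estimator \<open>a\<close>: total variance is error
    plus explained variance.\<close>
  then have "var_rv M U = mmse M U Z + q"
    using mmse_pythagoras[OF U Zm U2, of "\<lambda>_. a"] by (simp add: var_rv_def a_def H_def F_def)
  moreover have "q \<le> c * s\<^sup>2 * var_rv M U"
  proof -
    have Ua2: "integrable M (\<lambda>\<omega>. (U \<omega> - a)\<^sup>2)"
      by (rule integrable_diff_square) (use U2 in auto)
    have iUg: "integrable M (\<lambda>\<omega>. (U \<omega> - a) * g (S \<omega>))"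
      by (rule Cauchy_Schwarz_integral(1)[OF _ _ Ua2 gS2]) auto
    \<comment> \<open>\<open>g (S \<omega>)\<close> is the projection of \<open>U - a\<close>, so
      pairing the two gives the squared norm of the projection.\<close>
    have "q = expectation (\<lambda>\<omega>. (U \<omega> - a) * g (S \<omega>))"
    proof -
      have gF: "(\<lambda>\<omega>. g (S \<omega>)) \<in> borel_measurable F"
        using \<open>H \<in> borel_measurable F\<close> gS
        by (subst measurable_cong[where g="\<lambda>\<omega>. H \<omega> - a"]) (auto simp: F_def)
      have i: "integrable M (\<lambda>\<omega>. g (S \<omega>))"
        by (rule integrable_of_square[OF _ gS2]) simp
      have iU: "integrable M (\<lambda>\<omega>. g (S \<omega>) * U \<omega>)" "integrable M (\<lambda>\<omega>. g (S \<omega>) * H \<omega>)"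
        using Cauchy_Schwarz_integral(1)[OF _ _ gS2 U2] Cauchy_Schwarz_integral(1)[OF _ _ gS2 H(1)] H(2)
        by auto
      have "q = expectation (\<lambda>\<omega>. g (S \<omega>) * H \<omega> - a * g (S \<omega>))"
        unfolding qM[symmetric]
        by (intro Bochner_Integration.integral_cong refl) (simp add: gS[symmetric] power2_eq_square algebra_simps)
      also have "\<dots> = expectation (\<lambda>\<omega>. g (S \<omega>) * U \<omega> - a * g (S \<omega>))"
        using i iU H(3)[OF gF gS2] by simp
      finally show ?thesis by (simp add: algebra_simps)
    qed
    also have "\<dots> = (\<integral>p. (fst (fst p) - a) * g (s * snd (fst p) + sqrt (1 - s\<^sup>2) * snd p) \<partial>(J \<Otimes>\<^sub>M gauss))"
      unfolding joint by (subst integral_distr) (auto simp: S_def)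
    \<comment> \<open>Fubini with the noise as the inner variable.\<close>
    also have "\<dots> = (\<integral>p. (fst p - a) * mehler_op s g (snd p) \<partial>J)"
    proof -
      have "integrable (J \<Otimes>\<^sub>M gauss) (\<lambda>p. (fst (fst p) - a) * g (s * snd (fst p) + sqrt (1 - s\<^sup>2) * snd p))"
        unfolding joint by (subst integrable_distr_eq) (use iUg in \<open>auto simp: S_def\<close>)
      from JG.integral_fst'[OF this] show ?thesis
        by (simp add: integral_gauss_affine_mehler[OF s g])
    qed
    also have "\<dots> = expectation (\<lambda>\<omega>. (U \<omega> - a) * mehler_op s g (V \<omega>))"
      unfolding J_def by (subst integral_distr) auto
    finally have "q\<^sup>2 \<le> c * var_rv M U * expectation (\<lambda>\<omega>. (mehler_op s g (V \<omega>))\<^sup>2)"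
      using corr[of "mehler_op s g"] mehler_op_square(1)[OF g g2 s]
      by (simp add: a_def to_gauss(4)[of "\<lambda>x. (mehler_op s g x)\<^sup>2"])
    also have "\<dots> \<le> c * var_rv M U * (s\<^sup>2 * q)"
      using mehler_op_contraction[OF g g2 s mean] c var_rv_nonneg[of U]
      by (intro mult_left_mono) (simp_all add: to_gauss(2)[of "\<lambda>x. (mehler_op s g x)\<^sup>2"] q_def)
    finally have "q * q \<le> (c * s\<^sup>2 * var_rv M U) * q" by (simp add: power2_eq_square mult_ac)
    then show ?thesis
      using q c var_rv_nonneg[of U] by (cases "q = 0") simp_all
  qed
  ultimately show ?thesis by (simp add: algebra_simps)
qed

text \<open>The right-hand side is the error of the best affine estimator of \<open>U\<close> from
  the channel output.\<close>

lemma (in prob_space) mmse_linear_le: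
  fixes U Y N :: "'a \<Rightarrow> real"
  assumes \<gamma>: "0 \<le> \<gamma>"
    and U [measurable]: "U \<in> borel_measurable M" and U2: "integrable M (\<lambda>\<omega>. (U \<omega>)\<^sup>2)"
    and Y [measurable]: "Y \<in> borel_measurable M" and Y2: "integrable M (\<lambda>\<omega>. (Y \<omega>)\<^sup>2)"
    and N [measurable]: "N \<in> borel_measurable M" and N2: "integrable M (\<lambda>\<omega>. (N \<omega>)\<^sup>2)"
    and N0: "expectation N = 0" and N1: "expectation (\<lambda>\<omega>. (N \<omega>)\<^sup>2) = 1"
    and ind: "indep_var borel U borel N" "indep_var borel Y borel N"
  shows "mmse M U (\<lambda>\<omega>. sqrt \<gamma> * Y \<omega> + N \<omega>) \<le>
    var_rv M U - \<gamma> * (cov_rv M U Y)\<^sup>2 / (1 + \<gamma> * var_rv M Y)"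
proof -
  define r where "r = sqrt \<gamma>"
  have r2: "r\<^sup>2 = \<gamma>" using \<gamma> by (simp add: r_def)
  define u where "u = expectation U"
  define v where "v = expectation Y"
  have D: "0 < 1 + \<gamma> * var_rv M Y" using \<gamma> var_rv_nonneg[of Y] by (simp add: add_pos_nonneg)
  \<comment> \<open>The regression slope: covariance of \<open>U\<close> with the output, over the
    variance of the output. In \<open>l\<close>, \<open>r * v\<close> is the mean of the
    output.\<close>
  define b where "b = r * cov_rv M U Y / (1 + \<gamma> * var_rv M Y)"
  define l where "l z = u + b * (z - r * v)" for z
  \<comment> \<open>Independent noise of mean zero makes the cross terms of the expanded square
    vanish.\<close>
  have UN: "integrable M (\<lambda>\<omega>. (T \<omega> - t) * N \<omega>)" "expectation (\<lambda>\<omega>. (T \<omega> - t) * N \<omega>) = 0"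
    if T: "indep_var borel T borel N" "integrable M T" for T :: "'a \<Rightarrow> real" and t
  proof -
    have "indep_var borel ((\<lambda>x. x - t) \<circ> T) borel ((\<lambda>x. x) \<circ> N)"
      by (rule indep_var_compose[OF T(1)]) simp_all
    then have "indep_var borel (\<lambda>\<omega>. T \<omega> - t) borel N" by (simp add: comp_def)
    from indep_var_integrable[OF this] indep_var_lebesgue_integral[OF this]
    show "integrable M (\<lambda>\<omega>. (T \<omega> - t) * N \<omega>)" "expectation (\<lambda>\<omega>. (T \<omega> - t) * N \<omega>) = 0"
      using T(2) integrable_of_square[OF N N2] N0 by simp_all
  qed
  note UN' = UN[OF ind(1) integrable_of_square[OF U U2], of u]
  note YN' = UN[OF ind(2) integrable_of_square[OF Y Y2], of v]
  have Uu: "integrable M (\<lambda>\<omega>. (U \<omega> - u)\<^sup>2)" and Yv: "integrable M (\<lambda>\<omega>. (Y \<omega> - v)\<^sup>2)"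
    using integrable_diff_square[OF U U2, of "\<lambda>_. u"] integrable_diff_square[OF Y Y2, of "\<lambda>_. v"] by simp_all
  have UY: "integrable M (\<lambda>\<omega>. (U \<omega> - u) * (Y \<omega> - v))"
    by (rule Cauchy_Schwarz_integral(1)[OF _ _ Uu Yv]) simp_all
  have lZ: "integrable M (\<lambda>\<omega>. (l (r * Y \<omega> + N \<omega>))\<^sup>2)"
  proof -
    have "integrable M (\<lambda>\<omega>. u\<^sup>2 + 2 * u * b * r * (Y \<omega> - v) + 2 * u * b * N \<omega> +
        (b * r)\<^sup>2 * (Y \<omega> - v)\<^sup>2 + 2 * b\<^sup>2 * r * ((Y \<omega> - v) * N \<omega>) + b\<^sup>2 * (N \<omega>)\<^sup>2)"
      using integrable_of_square[OF Y Y2] integrable_of_square[OF N N2] Yv YN' N2 by simp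
    also have "(\<lambda>\<omega>. u\<^sup>2 + 2 * u * b * r * (Y \<omega> - v) + 2 * u * b * N \<omega> +
        (b * r)\<^sup>2 * (Y \<omega> - v)\<^sup>2 + 2 * b\<^sup>2 * r * ((Y \<omega> - v) * N \<omega>) + b\<^sup>2 * (N \<omega>)\<^sup>2) =
        (\<lambda>\<omega>. (l (r * Y \<omega> + N \<omega>))\<^sup>2)"
      by (rule ext) (simp add: l_def power2_eq_square algebra_simps)
    finally show ?thesis .
  qed
  have "mmse M U (\<lambda>\<omega>. r * Y \<omega> + N \<omega>) \<le> expectation (\<lambda>\<omega>. (U \<omega> - l (r * Y \<omega> + N \<omega>))\<^sup>2)"
    using mmse_le_estimator[of U "\<lambda>\<omega>. r * Y \<omega> + N \<omega>" l] U2 lZ by (simp add: l_def[abs_def])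
  also have "\<dots> = expectation (\<lambda>\<omega>. (U \<omega> - u)\<^sup>2 - 2 * b * r * ((U \<omega> - u) * (Y \<omega> - v))
      - 2 * b * ((U \<omega> - u) * N \<omega>) + (b * r)\<^sup>2 * (Y \<omega> - v)\<^sup>2
      + 2 * b\<^sup>2 * r * ((Y \<omega> - v) * N \<omega>) + b\<^sup>2 * (N \<omega>)\<^sup>2)"
    by (intro Bochner_Integration.integral_cong refl) (simp add: l_def power2_eq_square algebra_simps)
  also have "\<dots> = var_rv M U - 2 * b * r * cov_rv M U Y + (b * r)\<^sup>2 * var_rv M Y + b\<^sup>2"
    using Uu UY UN' YN' Yv N2 N1 by (simp add: var_rv_def cov_rv_def u_def v_def)
  also have "\<dots> = var_rv M U - 2 * b * (r * cov_rv M U Y) + b\<^sup>2 * (1 + \<gamma> * var_rv M Y)"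
    by (simp add: r2[symmetric] power_mult_distrib algebra_simps)
  also have "\<dots> = var_rv M U - (r * cov_rv M U Y)\<^sup>2 / (1 + \<gamma> * var_rv M Y)"
    unfolding b_def using D by (simp add: power2_eq_square divide_simps)
  also have "\<dots> = var_rv M U - \<gamma> * (cov_rv M U Y)\<^sup>2 / (1 + \<gamma> * var_rv M Y)"
    by (simp add: power_mult_distrib r2)
  finally show ?thesis by (simp add: r_def)
qed

section \<open>The bounds on \<open>sENSR\<close>\<close>

theorem theorem7:
  fixes M :: "'a measure" and X Y N :: "'a \<Rightarrow> real"
    and fXY :: "real \<times> real \<Rightarrow> real" and \<mu> \<sigma> \<epsilon> :: real
  assumes "prob_space M"
    and "X \<in> borel_measurable M" and "Y \<in> borel_measurable M" and "N \<in> borel_measurable M"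
    and "distributed M (lborel \<Otimes>\<^sub>M lborel) (\<lambda>\<omega>. (X \<omega>, Y \<omega>)) fXY"
    and "\<sigma> > 0" and "distributed M lborel Y (normal_density \<mu> \<sigma>)"
    and "integrable M (\<lambda>\<omega>. (X \<omega>)\<^sup>2)" and "0 < var_rv M X"
    and "pearson M X Y \<noteq> 0"
    and "distributed M lborel N std_normal_density"
    and "prob_space.indep_set M (sets (vimage_algebra (space M) (\<lambda>\<omega>. (X \<omega>, Y \<omega>)) (borel :: (real \<times> real) measure)))
           (sets (vimage_algebra (space M) N (borel :: real measure)))"
    and "0 \<le> \<epsilon>" and "\<epsilon> \<le> (maxcorr M X Y)\<^sup>2"
  shows "1 - \<epsilon> / (pearson M X Y)\<^sup>2 \<le> sENSR M X Y N \<epsilon> \<and>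
         sENSR M X Y N \<epsilon> \<le> 1 - \<epsilon> / (maxcorr M X Y)\<^sup>2"
proof -
  interpret prob_space M by fact
  note [measurable] = \<open>X \<in> borel_measurable M\<close> \<open>Y \<in> borel_measurable M\<close> \<open>N \<in> borel_measurable M\<close>
  note \<sigma> = \<open>\<sigma> > 0\<close>
  note dY = \<open>distributed M lborel Y (normal_density \<mu> \<sigma>)\<close>
  note dN = \<open>distributed M lborel N std_normal_density\<close>
  note X2 = \<open>integrable M (\<lambda>\<omega>. (X \<omega>)\<^sup>2)\<close>
  define V where "V \<omega> = (Y \<omega> - \<mu>) / \<sigma>" for \<omega>
  have [measurable]: "V \<in> borel_measurable M" unfolding V_def by measurable
  have dV: "distributed M lborel V std_normal_density"
    using normal_standard_normal_convert[OF \<sigma>] dY by (simp add: V_def[abs_def])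
  have YV: "Y \<omega> = \<mu> + \<sigma> * V \<omega>" for \<omega> using \<sigma> by (simp add: V_def)

  have std_sq: "integrable M (\<lambda>\<omega>. (T \<omega>)\<^sup>2)" if "distributed M lborel T std_normal_density" for T
    using distributed_integrable[OF that, of "\<lambda>x. x\<^sup>2"] integrable_std_normal_moment[of 2] by simp
  note N2 = std_sq[OF dN] and V2 = std_sq[OF dV]
  have N0: "expectation N = 0" by (rule standard_normal_distributed_expectation[OF dN])
  have N1: "expectation (\<lambda>\<omega>. (N \<omega>)\<^sup>2) = 1"
    using standard_normal_distributed_variance[OF dN] by (simp add: N0)
  have Y2: "integrable M (\<lambda>\<omega>. (Y \<omega>)\<^sup>2)"
    using V2 integrable_of_square[OF _ V2] by (simp add: YV power2_sum power_mult_distrib mult.assoc)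
  have varY: "var_rv M Y = \<sigma>\<^sup>2"
    using normal_distributed_variance[OF \<sigma> dY] by (simp add: var_rv_def)

  have XY [measurable]: "(\<lambda>\<omega>. (X \<omega>, Y \<omega>)) \<in> borel_measurable M"
    unfolding borel_prod[symmetric] by measurable
  note XYN = indep_set_vimage_compose[OF \<open>indep_set _ _\<close> XY, unfolded borel_prod[symmetric]]
  have XN: "indep_var borel X borel N" and YN: "indep_var borel Y borel N"
    using XYN[of fst borel] XYN[of snd borel] by (auto intro!: indep_var_vimage)

  define R where "R = (maxcorr M X Y)\<^sup>2"
  define P where "P = (pearson M X Y)\<^sup>2"
  have P: "0 < P" using \<open>pearson M X Y \<noteq> 0\<close> by (simp add: P_def)
  have P_eq: "(cov_rv M X Y)\<^sup>2 = P * (var_rv M X * \<sigma>\<^sup>2)"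
    using \<open>0 < var_rv M X\<close> \<sigma> by (simp add: P_def pearson_square var_rv_nonneg varY)
  \<comment> \<open>The identity functions compete in \<open>maxcorr\<close>, so \<open>R\<close>
    inherits positivity from \<open>P\<close>; it will be a divisor.\<close>
  have "(cov_rv M X Y)\<^sup>2 \<le> R * (var_rv M X * var_rv M Y)"
    unfolding R_def by (rule cov_rv_le_maxcorr[of X Y "\<lambda>x. x" "\<lambda>x. x"]) (simp_all add: X2 Y2)
  moreover have "0 < var_rv M X * \<sigma>\<^sup>2" using \<open>0 < var_rv M X\<close> \<sigma> by simp
  ultimately have R: "0 < R" using P unfolding P_eq varY by (meson mult_le_cancel_right_pos less_le_trans)

  \<comment> \<open>The channel in normalised form\<close>
  define Z where "Z \<gamma> \<omega> = sqrt \<gamma> * Y \<omega> + N \<omega>" for \<gamma> \<omega>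
  \<comment> \<open>The squared correlation of \<open>Y\<close> with \<open>Z \<gamma>\<close>,
    which is the square of the Mehler parameter.\<close>
  define snr where "snr \<gamma> = \<gamma> * \<sigma>\<^sup>2 / (1 + \<gamma> * \<sigma>\<^sup>2)" for \<gamma>
  have den: "0 < 1 + \<gamma> * \<sigma>\<^sup>2" if "0 \<le> \<gamma>" for \<gamma>
    using that by (simp add: add_pos_nonneg)
  have snr: "0 \<le> snr \<gamma>" "snr \<gamma> < 1" if "0 \<le> \<gamma>" for \<gamma>
    using that den[OF that] by (simp_all add: snr_def)
  have Zs: "Z \<gamma> \<omega> = sqrt \<gamma> * \<mu> + sqrt (1 + \<gamma> * \<sigma>\<^sup>2) *
      (sqrt (snr \<gamma>) * V \<omega> + sqrt (1 - (sqrt (snr \<gamma>))\<^sup>2) * N \<omega>)" if "0 \<le> \<gamma>" for \<gamma> \<omega>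
  proof -
    have "sqrt (1 + \<gamma> * \<sigma>\<^sup>2) * sqrt (snr \<gamma>) = sqrt (\<gamma> * \<sigma>\<^sup>2)"
      using den[OF that] by (simp add: real_sqrt_mult[symmetric] snr_def del: real_sqrt_mult)
    also have "\<dots> = sqrt \<gamma> * \<sigma>" using \<sigma> by (simp add: real_sqrt_mult)
    finally have 1: "sqrt (1 + \<gamma> * \<sigma>\<^sup>2) * sqrt (snr \<gamma>) = sqrt \<gamma> * \<sigma>" .
    have "1 - snr \<gamma> = 1 / (1 + \<gamma> * \<sigma>\<^sup>2)" using den[OF that] by (simp add: snr_def field_simps)
    then have 2: "sqrt (1 + \<gamma> * \<sigma>\<^sup>2) * sqrt (1 - (sqrt (snr \<gamma>))\<^sup>2) = 1"
      using den[OF that] snr[OF that] by (simp add: real_sqrt_divide)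
    have "sqrt \<gamma> * \<mu> + sqrt (1 + \<gamma> * \<sigma>\<^sup>2) *
      (sqrt (snr \<gamma>) * V \<omega> + sqrt (1 - (sqrt (snr \<gamma>))\<^sup>2) * N \<omega>) =
      sqrt \<gamma> * \<mu> + (sqrt (1 + \<gamma> * \<sigma>\<^sup>2) * sqrt (snr \<gamma>)) * V \<omega>
        + (sqrt (1 + \<gamma> * \<sigma>\<^sup>2) * sqrt (1 - (sqrt (snr \<gamma>))\<^sup>2)) * N \<omega>"
      by (simp only: distrib_left mult.assoc add.assoc)
    also have "\<dots> = sqrt \<gamma> * \<mu> + sqrt \<gamma> * \<sigma> * V \<omega> + N \<omega>" by (simp only: 1 2 mult_1_left)
    finally show ?thesis by (simp add: Z_def YV algebra_simps)
  qed
  \<comment> \<open>To be used for \<open>Y\<close> with \<open>c = 1\<close> and for functions of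
    \<open>X\<close> with \<open>c = R\<close>; \<open>\<psi>\<close> covers both.\<close>
  have channel: "(1 - c * snr \<gamma>) * var_rv M U \<le> mmse M U (Z \<gamma>)"
    if \<gamma>: "0 \<le> \<gamma>" and c: "0 \<le> c" and [measurable]: "\<psi> \<in> borel_measurable (borel \<Otimes>\<^sub>M borel)"
      and U: "U = (\<lambda>\<omega>. \<psi> (X \<omega>, Y \<omega>))" "integrable M (\<lambda>\<omega>. (U \<omega>)\<^sup>2)"
      and corr: "\<And>w. w \<in> borel_measurable borel \<Longrightarrow> integrable M (\<lambda>\<omega>. (w (Y \<omega>))\<^sup>2) \<Longrightarrow>
        (cov_rv M U (\<lambda>\<omega>. w (Y \<omega>)))\<^sup>2 \<le> c * (var_rv M U * var_rv M (\<lambda>\<omega>. w (Y \<omega>)))"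
    for \<gamma> c U and \<psi> :: "real \<times> real \<Rightarrow> real"
  proof -
    have Um [measurable]: "U \<in> borel_measurable M"
      unfolding U(1) by measurable
    have Ui: "integrable M U" by (rule integrable_of_square[OF Um U(2)])
    have ind: "indep_set (sets (vimage_algebra (space M) (\<lambda>\<omega>. (U \<omega>, V \<omega>)) (borel \<Otimes>\<^sub>M borel)))
        (sets (vimage_algebra (space M) N borel))"
      using XYN[of "\<lambda>p. (\<psi> p, (snd p - \<mu>) / \<sigma>)" "borel \<Otimes>\<^sub>M borel"] that(3)
      by (simp add: U(1) V_def)
    \<comment> \<open>From functions of \<open>Y\<close> to functions of \<open>V\<close>: the mean
      of \<open>W\<close> drops out of the covariance because \<open>U\<close> is centred, and the
      variance of \<open>W\<close> is at most its second moment.\<close>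
    have corrV: "(expectation (\<lambda>\<omega>. (U \<omega> - expectation U) * w (V \<omega>)))\<^sup>2 \<le>
        c * var_rv M U * expectation (\<lambda>\<omega>. (w (V \<omega>))\<^sup>2)"
      if [measurable]: "w \<in> borel_measurable borel" and w2: "integrable M (\<lambda>\<omega>. (w (V \<omega>))\<^sup>2)" for w
    proof -
      define W where "W \<omega> = w (V \<omega>)" for \<omega>
      have [measurable]: "W \<in> borel_measurable M" unfolding W_def by measurable
      have W2: "integrable M (\<lambda>\<omega>. (W \<omega>)\<^sup>2)" using w2 by (simp add: W_def)
      have Wi: "integrable M W" by (rule integrable_of_square[OF _ W2]) simp
      have UW: "integrable M (\<lambda>\<omega>. U \<omega> * W \<omega>)"
        by (rule Cauchy_Schwarz_integral(1)[OF _ _ U(2) W2]) simp_all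
      have "(cov_rv M U W)\<^sup>2 \<le> c * (var_rv M U * var_rv M W)"
        using corr[of "\<lambda>y. w ((y - \<mu>) / \<sigma>)"] w2 by (simp add: W_def[abs_def] V_def[abs_def])
      moreover have "cov_rv M U W = expectation (\<lambda>\<omega>. (U \<omega> - expectation U) * W \<omega>)"
        using UW Wi Ui prob_space by (simp add: cov_rv_def algebra_simps)
      moreover have "var_rv M W \<le> expectation (\<lambda>\<omega>. (W \<omega>)\<^sup>2)"
        using variance_eq[OF Wi W2] by (simp add: var_rv_def)
      then have "c * (var_rv M U * var_rv M W) \<le> c * (var_rv M U * expectation (\<lambda>\<omega>. (W \<omega>)\<^sup>2))"
        using c var_rv_nonneg[of U] by (intro mult_left_mono)
      ultimately show ?thesis by (simp add: W_def mult.assoc)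
    qed
    have "(1 - c * (sqrt (snr \<gamma>))\<^sup>2) * var_rv M U \<le> mmse M U (Z \<gamma>)"
      using snr[OF \<gamma>] by (intro mmse_gaussian_channel_ge[OF _ _ Um U(2) ind dV dN Zs[OF \<gamma>] c corrV]) auto
    then show ?thesis using snr[OF \<gamma>] by simp
  qed

  \<comment> \<open>Cauchy-Schwarz supplies the correlation bound with \<open>c = 1\<close>, and the
    linear estimator attains the resulting lower bound.\<close>
  have mmseY: "mmse M Y (Z \<gamma>) / var_rv M Y = 1 - snr \<gamma>" if \<gamma>: "0 \<le> \<gamma>" for \<gamma>
  proof -
    have "(1 - 1 * snr \<gamma>) * var_rv M Y \<le> mmse M Y (Z \<gamma>)"
      by (rule channel[OF \<gamma>, of 1 snd])
        (use Y2 in \<open>auto intro!: cov_rv_square_le\<close>)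
    moreover have "mmse M Y (Z \<gamma>) \<le> var_rv M Y - \<gamma> * (cov_rv M Y Y)\<^sup>2 / (1 + \<gamma> * var_rv M Y)"
      unfolding Z_def
      by (intro mmse_linear_le[OF \<gamma>] Y2 N2 N0 N1 YN) auto
    moreover have "cov_rv M Y Y = var_rv M Y"
      by (simp add: cov_rv_def var_rv_def power2_eq_square)
    moreover have "\<sigma>\<^sup>2 - \<gamma> * (\<sigma>\<^sup>2)\<^sup>2 / (1 + \<gamma> * \<sigma>\<^sup>2) = (1 - snr \<gamma>) * \<sigma>\<^sup>2"
      by (simp add: snr_def power2_eq_square algebra_simps)
    ultimately show ?thesis using \<sigma> by (simp add: varY)
  qed

  \<comment> \<open>Admissible values of \<open>\<gamma>\<close>\<close>
  define feasible where "feasible \<gamma> \<longleftrightarrow> 0 \<le> \<gamma> \<and>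
     (\<forall>f :: real \<Rightarrow> real. f \<in> borel_measurable borel \<longrightarrow> integrable M (\<lambda>\<omega>. (f (X \<omega>))\<^sup>2) \<longrightarrow>
        mmse M (\<lambda>\<omega>. f (X \<omega>)) (Z \<gamma>) \<ge> (1 - \<epsilon>) * var_rv M (\<lambda>\<omega>. f (X \<omega>)))" for \<gamma>
  have sENSR_eq: "sENSR M X Y N \<epsilon> = Inf {1 - snr \<gamma> | \<gamma>. feasible \<gamma>}"
  proof -
    have "{mmse M Y (Z \<gamma>) / var_rv M Y | \<gamma>. feasible \<gamma>} = {1 - snr \<gamma> | \<gamma>. feasible \<gamma>}"
      using mmseY by (auto simp: feasible_def) metis
    then show ?thesis by (simp add: sENSR_def feasible_def Z_def[abs_def])
  qed
  have feasibleI: "feasible \<gamma>" if \<gamma>: "0 \<le> \<gamma>" "R * snr \<gamma> \<le> \<epsilon>" for \<gamma>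
    unfolding feasible_def
  proof (intro conjI allI impI \<gamma>)
    fix f :: "real \<Rightarrow> real"
    assume f [measurable]: "f \<in> borel_measurable borel" and f2: "integrable M (\<lambda>\<omega>. (f (X \<omega>))\<^sup>2)"
    have "(1 - \<epsilon>) * var_rv M (\<lambda>\<omega>. f (X \<omega>)) \<le> (1 - R * snr \<gamma>) * var_rv M (\<lambda>\<omega>. f (X \<omega>))"
      using \<gamma> var_rv_nonneg by (intro mult_right_mono) auto
    also have "\<dots> \<le> mmse M (\<lambda>\<omega>. f (X \<omega>)) (Z \<gamma>)"
      by (rule channel[OF \<gamma>(1), of R "\<lambda>p. f (fst p)"])
        (use f2 R in \<open>auto simp: R_def intro!: cov_rv_le_maxcorr\<close>)
    finally show "(1 - \<epsilon>) * var_rv M (\<lambda>\<omega>. f (X \<omega>)) \<le> mmse M (\<lambda>\<omega>. f (X \<omega>)) (Z \<gamma>)" .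
  qed
  have feasibleD: "P * snr \<gamma> \<le> \<epsilon>" if "feasible \<gamma>" for \<gamma>
  proof -
    have \<gamma>: "0 \<le> \<gamma>" using that by (simp add: feasible_def)
    \<comment> \<open>Admissibility is tested on the identity function.\<close>
    have "(1 - \<epsilon>) * var_rv M X \<le> mmse M X (Z \<gamma>)"
      using that X2 unfolding feasible_def by (auto dest: spec[of _ "\<lambda>x. x"])
    also have "\<dots> \<le> var_rv M X - \<gamma> * (cov_rv M X Y)\<^sup>2 / (1 + \<gamma> * var_rv M Y)"
      unfolding Z_def
      by (intro mmse_linear_le[OF \<gamma>] X2 Y2 N2 N0 N1 XN YN) auto
    also have "\<dots> = (1 - P * snr \<gamma>) * var_rv M X"
      by (simp add: P_eq varY snr_def algebra_simps)
    finally show ?thesis using \<open>0 < var_rv M X\<close> by simp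
  qed
  \<comment> \<open>The witness solves \<open>snr \<gamma> = t\<close> for
    \<open>\<gamma>\<close>.\<close>
  have snr_onto: "\<exists>\<gamma>\<ge>0. snr \<gamma> = t" if "0 \<le> t" "t < 1" for t
    by (rule exI[of _ "t / ((1 - t) * \<sigma>\<^sup>2)"]) (use that \<sigma> in \<open>simp add: snr_def field_simps\<close>)
  have "snr 0 = 0" by (simp add: snr_def)
  then have "feasible 0" using \<open>0 \<le> \<epsilon>\<close> by (intro feasibleI) simp_all

  \<comment> \<open>The lower and the upper bound for the infimum\<close>
  have "1 - \<epsilon> / P \<le> sENSR M X Y N \<epsilon>"
    unfolding sENSR_eq
  proof (rule cInf_greatest)
    show "{1 - snr \<gamma> | \<gamma>. feasible \<gamma>} \<noteq> {}" using \<open>feasible 0\<close> by auto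
    show "1 - \<epsilon> / P \<le> x" if "x \<in> {1 - snr \<gamma> | \<gamma>. feasible \<gamma>}" for x
      using that feasibleD P by (auto simp: pos_le_divide_eq mult.commute)
  qed
  moreover have "sENSR M X Y N \<epsilon> \<le> 1 - \<epsilon> / R"
  proof -
    have bdd: "bdd_below {1 - snr \<gamma> | \<gamma>. feasible \<gamma>}"
      by (rule bdd_belowI[of _ 0]) (auto simp: feasible_def less_imp_le[OF snr(2)])
    have upper: "sENSR M X Y N \<epsilon> \<le> 1 - t" if t: "0 \<le> t" "t < 1" "R * t \<le> \<epsilon>" for t
    proof -
      obtain \<gamma> where "0 \<le> \<gamma>" "snr \<gamma> = t" using snr_onto[OF t(1,2)] by auto
      with t feasibleI show ?thesis
        unfolding sENSR_eq by (intro cInf_lower bdd) auto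
    qed
    show ?thesis
    \<comment> \<open>When \<open>\<epsilon> = R\<close> the target \<open>\<epsilon> / R\<close> is
      one, a value that \<open>snr\<close> never attains, so it is approached from below by some
      \<open>t < \<epsilon> / R\<close>.\<close>
    proof (rule ccontr)
      assume "\<not> ?thesis"
      then have less: "1 - sENSR M X Y N \<epsilon> < \<epsilon> / R" by simp
      have "\<epsilon> / R \<le> 1" using \<open>\<epsilon> \<le> (maxcorr M X Y)\<^sup>2\<close> R by (simp add: R_def)
      \<comment> \<open>This makes any \<open>t\<close> above
        \<open>1 - sENSR M X Y N \<epsilon>\<close> nonnegative, as \<open>upper\<close>
        demands.\<close>
      have "0 \<le> 1 - sENSR M X Y N \<epsilon>" using upper[of 0] \<open>0 \<le> \<epsilon>\<close> by simp
      with dense[OF less] obtain t where t: "1 - sENSR M X Y N \<epsilon> < t" "t < \<epsilon> / R" "0 \<le> t" by auto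
      have "R * t \<le> \<epsilon>" using t R by (simp add: pos_less_divide_eq mult.commute less_imp_le)
      with upper[of t] t \<open>\<epsilon> / R \<le> 1\<close> show False by simp
    qed
  qed
  ultimately show ?thesis by (simp add: P_def R_def)
qed

end
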